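(* Let $\Gamma=\langle\alpha_1,\ldots,\alpha_r\rangle\subset A$. For each $j\ge2$, the set $$\{\alpha\in\Gamma:\mathsf c(\alpha)=j\}$$ is a finite union of disjoint cones. In particular, the catenary degree function $\mathsf c:\Gamma\to\mathbb N$ is eventually quasiconstant.
   Context: $\mathbb N=\{0,1,2,\ldots\}$, $T$ is a finite abelian group, $d\ge1$, $A=\mathbb N^d\oplus T$. $\Gamma=\langle\alpha_1,\ldots,\alpha_r\rangle\subset A$ is a finitely generated subsemigroup (containing $0$) that is reduced ($0$ is its only invertible element), with unique minimal generating set $\alpha_1,\ldots,\alpha_r$. A factorization of $\alpha\in\Gamma$ is a tuple $\mathbf a\in\mathbb N^r$ with $\alpha=a_1\alpha_1+\cdots+a_r\alpha_r$; $\mathsf Z_\Gamma(\alpha)$ is the set of factorizations of $\alpha$, and $|\mathbf a|=a_1+\cdots+a_r$. Catenary degree: for $\mathbf a,\mathbf b\in\mathsf Z_\Gamma(\alpha)$, $\gcd(\mathbf a,\mathbf b)=(\min(a_1,b_1),\ldots,\min(a_r,b_r))$ and $d(\mathbf a,\mathbf b)=\max(|\mathbf a-\gcd(\mathbf a,\mathbf b)|,|\mathbf b-\gcd(\mathbf a,\mathbf b)|)$. For an integer $N\ge0$, an $N$-chain from $\mathbf a$ to $\mathbf b$ is a sequence $\mathbf a_1,\ldots,\mathbf a_k\in\mathsf Z_\Gamma(\alpha)$ with $\mathbf a_1=\mathbf a$, $\mathbf a_k=\mathbf b$, and $d(\mathbf a_{i-1},\mathbf a_i)\le N$ for all $2\le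 i\le k$. The catenary degree $\mathsf c(\alpha)$ is the smallest non-negative integer $N$ such that there is an $N$-chain between any two factorizations of $\alpha$. A cone in $A$ is a set $C(\beta;\gamma_1,\ldots,\gamma_s)=\{\beta+\sum_{j=1}^s c_j\gamma_j:c_1,\ldots,c_s\in\mathbb N\}$ with $\beta\in A$ and $\gamma_1,\ldots,\gamma_s\in A$ linearly independent over $\mathbb Z$ ($s\ge0$). A function $A\to\mathbb Q$ is eventually quasiconstant if it is a finite sum of functions each of which is constant on some cone and zero outside that cone. A function on $\Gamma$ is regarded as a function on $A$ by extending it by zero. *)

theory Defs
  imports "HOL-Analysis.Finite_Cartesian_Product" "HOL-Library.Disjoint_Sets"
begin

text \<open>
  The monoid \<open>\<nat>\<^sup>d \<oplus> T\<close> is the type \<open>(nat^'d) \<times> 't\<close> with \<open>'t\<close> a finite abelian group and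
  \<open>d = CARD('d) \<ge> 1\<close>. Tuples \<open>x\<^sub>1, \<dots>, x\<^sub>r\<close> are indexed from \<open>0\<close> to \<open>r - 1\<close>.
\<close>

primrec nsmul :: "nat \<Rightarrow> 'a::comm_monoid_add \<Rightarrow> 'a" where
  "nsmul 0 x = 0"
| "nsmul (Suc n) x = x + nsmul n x"

definition zsmul :: "int \<Rightarrow> 'a::ab_group_add \<Rightarrow> 'a" where
  "zsmul k x = (if 0 \<le> k then nsmul (nat k) x else - nsmul (nat (- k)) x)"

definition submonoid :: "'a::comm_monoid_add set \<Rightarrow> bool" where
  "submonoid H \<longleftrightarrow> 0 \<in> H \<and> (\<forall>x\<in>H. \<forall>y\<in>H. x + y \<in> H)"

definition reduced_monoid :: "'a::comm_monoid_add set \<Rightarrow> bool" where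
  "reduced_monoid H \<longleftrightarrow> (\<forall>x\<in>H. \<forall>y\<in>H. x + y = 0 \<longrightarrow> x = 0)"

definition minimal_generators ::
  "'a::comm_monoid_add set \<Rightarrow> nat \<Rightarrow> (nat \<Rightarrow> 'a) \<Rightarrow> bool" where
  "minimal_generators \<Gamma> r \<alpha> \<longleftrightarrow>
     inj_on \<alpha> {..<r} \<and> submonoid hull (\<alpha> ` {..<r}) = \<Gamma> \<and>
     (\<forall>S. S \<subset> \<alpha> ` {..<r} \<longrightarrow> submonoid hull S \<noteq> \<Gamma>)"

text \<open>
  Elements of \<open>\<nat>\<^sup>r\<close> are functions vanishing at all indices \<open>\<ge> r\<close>, so that distinct
  functions are distinct tuples.
\<close>

definition factorizations ::
  "nat \<Rightarrow> (nat \<Rightarrow> 'a::comm_monoid_add) \<Rightarrow> 'a \<Rightarrow> (nat \<Rightarrow> nat) set" where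
  "factorizations r \<alpha> x =
     {a. (\<forall>i\<ge>r. a i = 0) \<and> x = (\<Sum>i<r. nsmul (a i) (\<alpha> i))}"

definition fact_length :: "nat \<Rightarrow> (nat \<Rightarrow> nat) \<Rightarrow> nat" where
  "fact_length r a = (\<Sum>i<r. a i)"

definition fact_gcd :: "(nat \<Rightarrow> nat) \<Rightarrow> (nat \<Rightarrow> nat) \<Rightarrow> nat \<Rightarrow> nat" where
  "fact_gcd a b = (\<lambda>i. min (a i) (b i))"

definition fact_dist :: "nat \<Rightarrow> (nat \<Rightarrow> nat) \<Rightarrow> (nat \<Rightarrow> nat) \<Rightarrow> nat" where
  "fact_dist r a b =
     max (fact_length r (\<lambda>i. a i - fact_gcd a b i))
         (fact_length r (\<lambda>i. b i - fact_gcd a b i))"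

definition is_chain ::
  "nat \<Rightarrow> (nat \<Rightarrow> 'a::comm_monoid_add) \<Rightarrow> 'a \<Rightarrow> nat \<Rightarrow>
   (nat \<Rightarrow> nat) \<Rightarrow> (nat \<Rightarrow> nat) \<Rightarrow> (nat \<Rightarrow> nat) list \<Rightarrow> bool" where
  "is_chain r \<alpha> x N a b as \<longleftrightarrow>
     as \<noteq> [] \<and> hd as = a \<and> last as = b \<and> set as \<subseteq> factorizations r \<alpha> x \<and>
     (\<forall>i. Suc i < length as \<longrightarrow> fact_dist r (as ! i) (as ! Suc i) \<le> N)"

text \<open>
  If the \<open>\<alpha> i\<close> are the minimal generators of a reduced submonoid of \<open>\<nat>\<^sup>d \<oplus> T\<close>, then every element
  has only finitely many factorizations, so a suitable \<open>N\<close> exists and the minimum is attained.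
\<close>

definition catenary_degree :: "nat \<Rightarrow> (nat \<Rightarrow> 'a::comm_monoid_add) \<Rightarrow> 'a \<Rightarrow> nat" where
  "catenary_degree r \<alpha> x =
     (LEAST N. \<forall>a\<in>factorizations r \<alpha> x. \<forall>b\<in>factorizations r \<alpha> x.
        \<exists>as. is_chain r \<alpha> x N a b as)"

text \<open>Linear independence over \<open>\<int>\<close> is understood in the ambient group \<open>\<int>\<^sup>d \<oplus> T\<close>.\<close>

definition to_group :: "(nat^'d) \<times> 't \<Rightarrow> (int^'d) \<times> 't" where
  "to_group x = ((\<chi> i. int (fst x $ i)), snd x)"

definition lin_indep :: "nat \<Rightarrow> (nat \<Rightarrow> (nat^'d) \<times> 't::ab_group_add) \<Rightarrow> bool" where
  "lin_indep s \<gamma> \<longleftrightarrow>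
     (\<forall>c :: nat \<Rightarrow> int. (\<Sum>j<s. zsmul (c j) (to_group (\<gamma> j))) = 0 \<longrightarrow> (\<forall>j<s. c j = 0))"

definition cone_of ::
  "'a::comm_monoid_add \<Rightarrow> nat \<Rightarrow> (nat \<Rightarrow> 'a) \<Rightarrow> 'a set" where
  "cone_of \<beta> s \<gamma> = {\<beta> + (\<Sum>j<s. nsmul (c j) (\<gamma> j)) | c :: nat \<Rightarrow> nat. True}"

definition is_cone :: "((nat^'d) \<times> 't::ab_group_add) set \<Rightarrow> bool" where
  "is_cone C \<longleftrightarrow> (\<exists>\<beta> s \<gamma>. lin_indep s \<gamma> \<and> C = cone_of \<beta> s \<gamma>)"

definition eventually_quasiconstant ::
  "((nat^'d) \<times> 't::ab_group_add \<Rightarrow> rat) \<Rightarrow> bool" where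
  "eventually_quasiconstant f \<longleftrightarrow>
     (\<exists>n (C :: nat \<Rightarrow> ((nat^'d) \<times> 't) set) (q :: nat \<Rightarrow> rat).
        (\<forall>i<n. is_cone (C i)) \<and> f = (\<lambda>x. \<Sum>i<n. if x \<in> C i then q i else 0))"

definition extend_by_zero :: "'a set \<Rightarrow> ('a \<Rightarrow> rat) \<Rightarrow> 'a \<Rightarrow> rat" where
  "extend_by_zero \<Gamma> f = (\<lambda>x. if x \<in> \<Gamma> then f x else 0)"

end

theory Submission
  imports Defs "HOL-Analysis.Cartesian_Space"
begin

text \<open>
The theorem combines two facts: the set of elements on which the catenary degree exceeds a given
bound is a finite union of finitely generated affine monoids, and differences of such sets are
finite disjoint unions of cones.

For \<open>N \<in> \<nat>\<close> let \<open>U N\<close> (below \<open>disconnected r \<alpha> N\<close>) be the set of elements having two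
factorizations that no \<open>N\<close>-chain joins. The catenary degree of \<open>x\<close> is at most \<open>N\<close> exactly if
\<open>x \<notin> U N\<close>, so \<open>{c = j} = U (j - 1) - U j\<close> for \<open>j \<ge> 1\<close>. Being joined by an \<open>N\<close>-chain is a congruence
on \<open>\<nat>\<^sup>r\<close>, and so is having the same value in \<open>\<Gamma>\<close>. For a congruence, the tuples that are not
lexicographically least in their class form an up-closed set, as in the theory of Groebner bases
of binomial ideals. Since the classes of the first congruence refine those of the second, an
element lies in \<open>U N\<close> iff it is the value of a tuple that is least in its \<open>N\<close>-chain class but not
least among all factorizations. Thus \<open>U N\<close> is the image of a difference of two up-closed subsets
of \<open>\<nat>\<^sup>r\<close> (\<open>disconnected_eq\<close>). By Dickson's lemma, membership in an up-closed set depends only on a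
truncation of the tuple at some height \<open>M\<close> (\<open>truncation\<close>). This cuts the difference into finitely
many translates of coordinate monoids (\<open>disconnected_cells\<close>), and it also shows that \<open>U N\<close> is empty
for all large \<open>N\<close> (\<open>disconnected_eventually_empty\<close>), so that the catenary degree is bounded.
Choosing the coordinate steps divisible by \<open>CARD('t)\<close> kills their torsion component; after fixing
the component in \<open>T\<close> one is left with sets \<open>\<beta> + \<langle>G\<rangle>\<close> in \<open>\<nat>\<^sup>d\<close>.

For the second fact, call a subset \<open>X\<close> of \<open>\<rat>\<^sup>d\<close> tame if it cuts every cone \<open>K\<close> in \<open>\<nat>\<^sup>d\<close> with linearly
independent generators into two sets, \<open>K \<inter> X\<close> and \<open>K - X\<close>, that are both finite disjoint unions of such cones.
Tame sets form a Boolean algebra. Half-spaces and sets defined by the integrality of a linear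
form are tame (\<open>tame_halfspace\<close>, \<open>tame_integral\<close>): cones are subdivided until the linear form is
under control. A cone with independent generators is cut out by such conditions on the
coordinates with respect to a basis, so it is tame, and a discrete form of Caratheodory's theorem
(\<open>ncone_reduce\<close>), applied repeatedly, writes every \<open>\<beta> + \<langle>G\<rangle>\<close> as a finite union of cones with independent generators.
Hence all \<open>\<beta> + \<langle>G\<rangle>\<close> are tame (\<open>tame_ncone\<close>), and so are the slices of \<open>U (j - 1) - U j\<close>. Cutting the
cone \<open>\<nat>\<^sup>d\<close> with these slices gives the required cones.
\<close>

section \<open>Disjoint unions of simplicial cones\<close>

definition nat_vecs :: "(rat^'d) set" where
  "nat_vecs = {x. \<forall>i. x $ i \<in> \<nat>}"

text \<open>
The translate \<open>\<beta> + \<langle>B\<rangle>\<close> of the monoid generated by \<open>B\<close>, for finite \<open>B\<close>. The ambient space is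
rational, not real: it has the linear algebra of a vector space, while the values of a linear
form on a finite set of generators still have a common denominator.
\<close>
definition ncone :: "rat^'d \<Rightarrow> (rat^'d) set \<Rightarrow> (rat^'d) set" where
  "ncone \<beta> B = {\<beta> + (\<Sum>b\<in>B. of_nat (c b) *s b) | c :: rat^'d \<Rightarrow> nat. True}"

definition simplicial :: "(rat^'d) set \<Rightarrow> bool" where
  "simplicial K \<longleftrightarrow> (\<exists>\<beta> B. \<beta> \<in> nat_vecs \<and> B \<subseteq> nat_vecs \<and> finite B \<and>
     vec.independent B \<and> K = ncone \<beta> B)"

definition conical :: "(rat^'d) set \<Rightarrow> bool" where
  "conical X \<longleftrightarrow> (\<exists>\<C>. finite \<C> \<and> (\<forall>C\<in>\<C>. simplicial C) \<and> disjoint \<C> \<and> X = \<Union>\<C>)"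

definition splits :: "(rat^'d) set \<Rightarrow> (rat^'d) set \<Rightarrow> bool" where
  "splits X K \<longleftrightarrow> conical (K \<inter> X) \<and> conical (K - X)"

definition tame :: "(rat^'d) set \<Rightarrow> bool" where
  "tame X \<longleftrightarrow> (\<forall>K. simplicial K \<longrightarrow> splits X K)"

lemma nat_vecs_add: "x \<in> nat_vecs \<Longrightarrow> y \<in> nat_vecs \<Longrightarrow> x + y \<in> nat_vecs"
  by (auto simp: nat_vecs_def)

lemma nat_vecs_scale: "x \<in> nat_vecs \<Longrightarrow> of_nat k *s x \<in> nat_vecs"
  by (auto simp: nat_vecs_def)

lemma simplicialI:
  "\<beta> \<in> nat_vecs \<Longrightarrow> B \<subseteq> nat_vecs \<Longrightarrow> finite B \<Longrightarrow> vec.independent B \<Longrightarrow> simplicial (ncone \<beta> B)"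
  unfolding simplicial_def by blast

lemma ncone_insert:
  assumes "finite B" "b \<notin> B"
  shows "x \<in> ncone \<beta> (insert b B) \<longleftrightarrow> (\<exists>y\<in>ncone \<beta> B. \<exists>k. x = y + of_nat k *s b)"
proof
  assume "x \<in> ncone \<beta> (insert b B)"
  then obtain c where "x = \<beta> + (\<Sum>b\<in>insert b B. of_nat (c b) *s b)"
    by (auto simp: ncone_def)
  with assms have "x = (\<beta> + (\<Sum>b\<in>B. of_nat (c b) *s b)) + of_nat (c b) *s b"
    by (simp add: algebra_simps)
  then show "\<exists>y\<in>ncone \<beta> B. \<exists>k. x = y + of_nat k *s b"
    unfolding ncone_def by blast
next
  assume "\<exists>y\<in>ncone \<beta> B. \<exists>k. x = y + of_nat k *s b"
  then obtain c k where x: "x = \<beta> + (\<Sum>b\<in>B. of_nat (c b) *s b) + of_nat k *s b"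
    by (auto simp: ncone_def)
  have "(\<Sum>b'\<in>B. of_nat ((c(b := k)) b') *s b') = (\<Sum>b\<in>B. of_nat (c b) *s b)"
    using assms by (intro sum.cong) auto
  then have "x = \<beta> + (\<Sum>b'\<in>insert b B. of_nat ((c(b := k)) b') *s b')"
    using assms x by (simp add: algebra_simps)
  then show "x \<in> ncone \<beta> (insert b B)"
    unfolding ncone_def by blast
qed

lemma ncone_shift: "x \<in> ncone (\<beta> + v) B \<longleftrightarrow> x - v \<in> ncone \<beta> B"
proof -
  have "x = \<beta> + v + s \<longleftrightarrow> x - v = \<beta> + s" for s
    by (auto simp: algebra_simps)
  then show ?thesis
    unfolding ncone_def by auto
qed

lemma ncone_insert_shift:
  assumes "finite B" "b \<notin> B"
  shows "x \<in> ncone (\<beta> + v) (insert b B) \<longleftrightarrow> (\<exists>y\<in>ncone \<beta> B. \<exists>k. x - v = y + of_nat k *s b)"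
  by (subst ncone_shift) (rule ncone_insert[OF assms])

lemma ncone_diff_span:
  assumes "x \<in> ncone \<beta> B" "y \<in> ncone \<beta> B"
  shows "x - y \<in> vec.span B"
proof -
  have "(\<Sum>b\<in>B. of_nat (c b) *s b) \<in> vec.span B" for c :: "rat^'a \<Rightarrow> nat"
    by (intro vec.span_sum vec.span_scale vec.span_base)
  moreover obtain c c' :: "rat^'a \<Rightarrow> nat" where
    "x - y = (\<Sum>b\<in>B. of_nat (c b) *s b) - (\<Sum>b\<in>B. of_nat (c' b) *s b)"
    using assms by (auto simp: ncone_def)
  ultimately show ?thesis
    by (simp add: vec.span_diff)
qed

text \<open>
Coefficients with respect to independent generators are unique. All disjointness claims about
subdivided cones rest on this.
\<close>
lemma ncone_coeff_unique:
  assumes "vec.independent (insert b B)" "b \<notin> B" "y \<in> ncone \<beta> B" "y' \<in> ncone \<beta> B"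
    "y + s *s b = y' + t *s b"
  shows "s = t"
proof (rule ccontr)
  assume "s \<noteq> t"
  have "y' - y = (s - t) *s b"
    using assms(5) by (simp add: algebra_simps vec.scale_left_diff_distrib)
  then have "(1 / (s - t)) *s ((s - t) *s b) \<in> vec.span B"
    using ncone_diff_span[OF assms(4,3)] by (metis vec.span_scale)
  then have "b \<in> vec.span B"
    using \<open>s \<noteq> t\<close> by simp
  with assms(1,2) show False
    by (simp add: vec.independent_insert)
qed

lemma conical_empty [simp]: "conical {}"
  unfolding conical_def by (rule exI[of _ "{}"]) auto

lemma conical_simplicial: "simplicial K \<Longrightarrow> conical K"
  unfolding conical_def by (rule exI[of _ "{K}"]) (auto simp: disjoint_def)

lemma conical_Un:
  assumes "conical X" "conical Y" "X \<inter> Y = {}"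
  shows "conical (X \<union> Y)"
proof -
  obtain \<C> where C: "finite \<C>" "\<forall>C\<in>\<C>. simplicial C" "disjoint \<C>" "X = \<Union>\<C>"
    using assms(1) unfolding conical_def by auto
  obtain \<D> where D: "finite \<D>" "\<forall>C\<in>\<D>. simplicial C" "disjoint \<D>" "Y = \<Union>\<D>"
    using assms(2) unfolding conical_def by auto
  have "disjoint (\<C> \<union> \<D>)"
    using C D assms(3) by (intro disjoint_union) auto
  with C D show ?thesis
    unfolding conical_def by (intro exI[of _ "\<C> \<union> \<D>"]) auto
qed

lemma conical_UN:
  assumes "finite I" "\<And>i. i \<in> I \<Longrightarrow> conical (X i)" "disjoint_family_on X I"
  shows "conical (\<Union>i\<in>I. X i)"
  using assms
proof (induction I)
  case (insert i I)
  have "X i \<inter> (\<Union>i\<in>I. X i) = {}"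
    using insert.prems(2) insert.hyps(2) by (force simp: disjoint_family_on_def)
  moreover have "conical (\<Union>i\<in>I. X i)"
    using insert by (auto simp: disjoint_family_on_def)
  ultimately show ?case
    using conical_Un[of "X i"] insert.prems by simp
qed simp

lemma splits_Un:
  assumes "splits X K" "splits X L" "K \<inter> L = {}"
  shows "splits X (K \<union> L)"
proof -
  have "conical ((K \<inter> X) \<union> (L \<inter> X))" "conical ((K - X) \<union> (L - X))"
    using assms by (auto simp: splits_def intro!: conical_Un)
  then show ?thesis
    by (simp add: splits_def Int_Un_distrib2 Un_Diff)
qed

lemma splits_UN:
  assumes "finite I" "\<And>i. i \<in> I \<Longrightarrow> splits X (K i)" "disjoint_family_on K I"
  shows "splits X (\<Union>i\<in>I. K i)"
proof -
  have "conical (\<Union>i\<in>I. K i \<inter> X)"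
    using assms by (intro conical_UN) (auto simp: splits_def disjoint_family_on_def)
  moreover have "conical (\<Union>i\<in>I. K i - X)"
    using assms by (intro conical_UN) (auto simp: splits_def disjoint_family_on_def)
  moreover have "(\<Union>i\<in>I. K i \<inter> X) = (\<Union>i\<in>I. K i) \<inter> X" "(\<Union>i\<in>I. K i - X) = (\<Union>i\<in>I. K i) - X"
    by auto
  ultimately show ?thesis
    by (simp add: splits_def)
qed

lemma splits_trivial: "simplicial K \<Longrightarrow> K \<subseteq> X \<or> K \<inter> X = {} \<Longrightarrow> splits X K"
  by (auto simp: splits_def conical_simplicial Int_absorb2 Diff_triv
      Diff_eq_empty_iff[THEN iffD2])

text \<open>
Tameness tests only single cones, but cutting a disjoint union of cones amounts to cutting each
of its members. This makes tame sets closed under intersection.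
\<close>
lemma tame_splits_conical:
  assumes "tame X" "conical S"
  shows "splits X S"
proof -
  obtain \<C> where C: "finite \<C>" "\<forall>C\<in>\<C>. simplicial C" "disjoint \<C>" "S = \<Union>\<C>"
    using assms(2) unfolding conical_def by auto
  have "splits X (\<Union>C\<in>\<C>. C)"
    using C assms(1) by (intro splits_UN) (auto simp: tame_def disjoint_family_on_def disjoint_def)
  with C show ?thesis by simp
qed

lemma tame_Compl: "tame X \<Longrightarrow> tame (- X)"
  by (simp add: tame_def splits_def Diff_eq)

lemma tame_Int:
  assumes "tame X" "tame Y"
  shows "tame (X \<inter> Y)"
  unfolding tame_def
proof (intro allI impI)
  fix K :: "(rat^'a) set"
  assume "simplicial K"
  then have X: "splits X K"
    using assms by (simp add: tame_def)
  then have Y: "splits Y (K \<inter> X)"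
    using tame_splits_conical[OF assms(2)] by (simp add: splits_def)
  have "conical ((K - X) \<union> ((K \<inter> X) - Y))"
    using X Y by (intro conical_Un) (auto simp: splits_def)
  moreover have "(K - X) \<union> ((K \<inter> X) - Y) = K - (X \<inter> Y)"
    by auto
  ultimately show "splits (X \<inter> Y) K"
    using Y by (simp add: splits_def Int_assoc)
qed

lemma tame_Un: "tame X \<Longrightarrow> tame Y \<Longrightarrow> tame (X \<union> Y)"
  using tame_Compl[OF tame_Int[OF tame_Compl tame_Compl, of X Y]] by simp

lemma tame_Diff: "tame X \<Longrightarrow> tame Y \<Longrightarrow> tame (X - Y)"
  by (simp add: Diff_eq tame_Int tame_Compl)

lemma tame_empty [simp]: "tame {}"
  by (simp add: tame_def splits_trivial)

lemma tame_UN: "finite I \<Longrightarrow> (\<And>i. i \<in> I \<Longrightarrow> tame (X i)) \<Longrightarrow> tame (\<Union>i\<in>I. X i)"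
  by (induction I rule: finite_induct) (auto intro: tame_Un)

lemma tame_INT: "finite I \<Longrightarrow> (\<And>i. i \<in> I \<Longrightarrow> tame (X i)) \<Longrightarrow> tame (\<Inter>i\<in>I. X i)"
  using tame_Compl[OF tame_UN[of I "\<lambda>i. - X i"]] by (simp add: tame_Compl)

text \<open>
A cone falls apart into the face on which the coefficient of \<open>b\<close> vanishes and a translate of
the cone itself by \<open>b\<close>.
\<close>
lemma splits_face:
  assumes "finite B" "b \<notin> B" "vec.independent (insert b B)"
    and "splits X (ncone \<beta> B)" "splits X (ncone (\<beta> + b) (insert b B))"
  shows "splits X (ncone \<beta> (insert b B))"
proof -
  have "ncone \<beta> (insert b B) = ncone \<beta> B \<union> ncone (\<beta> + b) (insert b B)"
  proof (intro set_eqI iffI)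
    fix x assume "x \<in> ncone \<beta> (insert b B)"
    then obtain y k where y: "y \<in> ncone \<beta> B" "x = y + of_nat k *s b"
      using ncone_insert assms(1,2) by blast
    show "x \<in> ncone \<beta> B \<union> ncone (\<beta> + b) (insert b B)"
    proof (cases k)
      case (Suc l)
      then have "x - b = y + of_nat l *s b"
        using y by (simp add: algebra_simps vec.scale_left_distrib)
      then show ?thesis
        using y ncone_insert_shift[OF assms(1,2)] by blast
    qed (use y in auto)
  next
    fix x assume "x \<in> ncone \<beta> B \<union> ncone (\<beta> + b) (insert b B)"
    then show "x \<in> ncone \<beta> (insert b B)"
    proof
      assume "x \<in> ncone \<beta> B"
      then show ?thesis
        using ncone_insert[OF assms(1,2)] by (metis add.right_neutral of_nat_0 vec.scale_zero_left)
    next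
      assume "x \<in> ncone (\<beta> + b) (insert b B)"
      then obtain y k where "y \<in> ncone \<beta> B" "x - b = y + of_nat k *s b"
        using ncone_insert_shift[OF assms(1,2)] by blast
      moreover from this have "x = y + of_nat (Suc k) *s b"
        by (simp add: algebra_simps vec.scale_left_distrib)
      ultimately show ?thesis
        using ncone_insert[OF assms(1,2)] by blast
    qed
  qed
  moreover have "ncone \<beta> B \<inter> ncone (\<beta> + b) (insert b B) = {}"
  proof (intro equals0I, elim IntE)
    fix x assume x: "x \<in> ncone \<beta> B" "x \<in> ncone (\<beta> + b) (insert b B)"
    then obtain y k where y: "y \<in> ncone \<beta> B" "x - b = y + of_nat k *s b"
      using ncone_insert_shift[OF assms(1,2)] by blast
    then have "x + 0 *s b = y + of_nat (Suc k) *s b"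
      by (simp add: algebra_simps vec.scale_left_distrib)
    from ncone_coeff_unique[OF assms(3,2) x(1) y(1) this] show False
      using of_nat_neq_0 by metis
  qed
  ultimately show ?thesis
    using splits_Un assms(4,5) by metis
qed

lemma multiple_notin_span:
  fixes b :: "rat^'d"
  assumes "vec.independent (insert b B)" "b \<notin> B" "0 < k"
  shows "of_nat k *s b \<notin> vec.span B"
proof
  assume "of_nat k *s b \<in> vec.span B"
  then have "(1 / of_nat k) *s (of_nat k *s b) \<in> vec.span B"
    by (rule vec.span_scale)
  then show False
    using assms by (simp add: vec.independent_insert)
qed

text \<open>
A cone falls apart according to the residue modulo \<open>k\<close> of the coefficient of \<open>b\<close>. The price for
replacing the generator \<open>b\<close> by its multiple \<open>k b\<close> is thus a finite number of translates.
\<close>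
lemma splits_residue:
  assumes "finite B" "b \<notin> B" "vec.independent (insert b B)" "0 < k"
    and "\<And>\<rho>. \<rho> < k \<Longrightarrow> splits X (ncone (\<beta> + of_nat \<rho> *s b) (insert (of_nat k *s b) B))"
  shows "splits X (ncone \<beta> (insert b B))"
proof -
  let ?K = "\<lambda>\<rho>. ncone (\<beta> + of_nat \<rho> *s b) (insert (of_nat k *s b) B)"
  have nin: "of_nat k *s b \<notin> B"
    using multiple_notin_span[OF assms(3,2,4)] vec.span_base by blast
  have mem: "x \<in> ?K \<rho> \<longleftrightarrow> (\<exists>y\<in>ncone \<beta> B. \<exists>q. x = y + of_nat (q * k + \<rho>) *s b)" for x \<rho>
  proof -
    have "x - of_nat \<rho> *s b = y + of_nat q *s (of_nat k *s b) \<longleftrightarrow>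
        x = y + of_nat (q * k + \<rho>) *s b" for y q
      by (auto simp: algebra_simps vec.scale_left_distrib)
    then show ?thesis
      by (simp only: ncone_insert_shift[OF assms(1) nin])
  qed
  have "ncone \<beta> (insert b B) = (\<Union>\<rho>\<in>{..<k}. ?K \<rho>)"
  proof (intro set_eqI iffI)
    fix x assume "x \<in> ncone \<beta> (insert b B)"
    then obtain y l where y: "y \<in> ncone \<beta> B" "x = y + of_nat l *s b"
      using ncone_insert[OF assms(1,2)] by blast
    then have "x = y + of_nat ((l div k) * k + l mod k) *s b"
      by simp
    then have "x \<in> ?K (l mod k)"
      using y(1) mem by blast
    then show "x \<in> (\<Union>\<rho>\<in>{..<k}. ?K \<rho>)"
      using \<open>0 < k\<close> by auto
  next
    fix x assume "x \<in> (\<Union>\<rho>\<in>{..<k}. ?K \<rho>)"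
    then show "x \<in> ncone \<beta> (insert b B)"
      using mem ncone_insert[OF assms(1,2)] by blast
  qed
  moreover have "disjoint_family_on ?K {..<k}"
  proof (unfold disjoint_family_on_def, intro ballI impI equals0I, elim IntE)
    fix \<rho> \<sigma> x
    assume r: "\<rho> \<in> {..<k}" "\<sigma> \<in> {..<k}" "\<rho> \<noteq> \<sigma>" and x: "x \<in> ?K \<rho>" "x \<in> ?K \<sigma>"
    obtain y p where y: "y \<in> ncone \<beta> B" "x = y + of_nat (p * k + \<rho>) *s b"
      using x(1) mem by blast
    obtain z q where z: "z \<in> ncone \<beta> B" "x = z + of_nat (q * k + \<sigma>) *s b"
      using x(2) mem by blast
    have "of_nat (p * k + \<rho>) = (of_nat (q * k + \<sigma>) :: rat)"
      using ncone_coeff_unique[OF assms(3,2) y(1) z(1)] y(2) z(2) by metis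
    then have "p * k + \<rho> = q * k + \<sigma>"
      using of_nat_eq_iff by blast
    then have "(p * k + \<rho>) mod k = (q * k + \<sigma>) mod k"
      by simp
    with r show False
      by simp
  qed
  ultimately show ?thesis
    using splits_UN[of "{..<k}" X ?K] assms(5) by simp
qed

lemma independent_shear:
  assumes "vec.independent (insert a (insert b B))" "a \<noteq> b" "a \<notin> B" "b \<notin> B"
  shows "a + b \<notin> insert b B" "vec.independent (insert (a + b) (insert b B))"
proof -
  have *: "a \<notin> vec.span (insert b B)" "vec.independent (insert b B)"
    using assms by (auto simp: vec.independent_insert)
  have "a + b \<notin> vec.span (insert b B)"
  proof
    assume "a + b \<in> vec.span (insert b B)"
    then have "(a + b) - b \<in> vec.span (insert b B)"
      by (intro vec.span_diff) (auto intro: vec.span_base)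
    with * show False by simp
  qed
  then show "a + b \<notin> insert b B" "vec.independent (insert (a + b) (insert b B))"
    using * vec.span_base by (blast, simp add: vec.independent_insertI)
qed

text \<open>
Stellar subdivision at \<open>a + b\<close>. A point \<open>y + i a + j b\<close> with \<open>j \<le> i\<close> is \<open>y + (i - j) a + j (a + b)\<close>, and
one with \<open>i < j\<close> is \<open>(y + b) + (j - i - 1) b + i (a + b)\<close>. The translation by \<open>b\<close> in the second
cone makes the two parts disjoint.
\<close>
lemma splits_subdivide:
  assumes "finite B" "a \<noteq> b" "a \<notin> B" "b \<notin> B" "vec.independent (insert a (insert b B))"
    and "splits X (ncone \<beta> (insert (a + b) (insert a B)))"
    and "splits X (ncone (\<beta> + b) (insert (a + b) (insert b B)))"
  shows "splits X (ncone \<beta> (insert a (insert b B)))"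
proof -
  have ind: "vec.independent (insert b (insert a B))" "vec.independent (insert a (insert b B))"
    using assms(5) by (simp_all add: insert_commute)
  have indB: "vec.independent (insert b B)" "vec.independent (insert a B)"
    using ind vec.independent_mono by blast+
  have nin: "a + b \<notin> insert b B" "a + b \<notin> insert a B"
    using independent_shear(1)[OF ind(2)] independent_shear(1)[OF ind(1)] assms
    by (auto simp: add.commute)
  have K: "x \<in> ncone \<beta> (insert a (insert b B)) \<longleftrightarrow>
      (\<exists>y\<in>ncone \<beta> B. \<exists>i j. x = y + of_nat i *s a + of_nat j *s b)" for x
  proof -
    have "x = y + of_nat j *s b + of_nat i *s a \<longleftrightarrow> x = y + of_nat i *s a + of_nat j *s b" for y i j
      by (simp add: algebra_simps)
    then show ?thesis
      using assms(1-4) by (simp add: ncone_insert Bex_def) blast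
  qed
  have L: "x \<in> ncone \<beta> (insert (a + b) (insert a B)) \<longleftrightarrow>
      (\<exists>y\<in>ncone \<beta> B. \<exists>i j. x = y + of_nat (i + j) *s a + of_nat j *s b)" for x
  proof -
    have "x = y + of_nat i *s a + of_nat j *s (a + b) \<longleftrightarrow>
        x = y + of_nat (i + j) *s a + of_nat j *s b" for y i j
      by (simp add: algebra_simps vec.scale_left_distrib vec.scale_right_distrib)
    then show ?thesis
      using assms(1-4) nin by (simp add: ncone_insert Bex_def) blast
  qed
  have R: "x \<in> ncone (\<beta> + b) (insert (a + b) (insert b B)) \<longleftrightarrow>
      (\<exists>y\<in>ncone \<beta> B. \<exists>i j. x = y + of_nat i *s a + of_nat (Suc (i + j)) *s b)" for x
  proof -
    have "x - b = y + of_nat j *s b + of_nat i *s (a + b) \<longleftrightarrow>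
        x = y + of_nat i *s a + of_nat (Suc (i + j)) *s b" for y i j
      by (auto simp add: algebra_simps vec.scale_left_distrib vec.scale_right_distrib)
    then show ?thesis
      using assms(1-4) nin by (simp add: ncone_insert ncone_shift Bex_def) blast
  qed
  have "ncone \<beta> (insert a (insert b B)) =
      ncone \<beta> (insert (a + b) (insert a B)) \<union> ncone (\<beta> + b) (insert (a + b) (insert b B))"
  proof (intro set_eqI iffI)
    fix x assume "x \<in> ncone \<beta> (insert a (insert b B))"
    then obtain y i j where y: "y \<in> ncone \<beta> B" "x = y + of_nat i *s a + of_nat j *s b"
      using K by blast
    show "x \<in> ncone \<beta> (insert (a + b) (insert a B)) \<union> ncone (\<beta> + b) (insert (a + b) (insert b B))"
    proof (cases "j \<le> i")
      case True
      then obtain k where "i = k + j"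
        by (metis le_iff_add add.commute)
      with y L show ?thesis by blast
    next
      case False
      then obtain k where "j = Suc (i + k)"
        using less_iff_Suc_add by (metis not_le)
      with y R show ?thesis by blast
    qed
  qed (use K L R in blast)
  moreover have "ncone \<beta> (insert (a + b) (insert a B)) \<inter>
      ncone (\<beta> + b) (insert (a + b) (insert b B)) = {}"
  proof (intro equals0I, elim IntE)
    fix x
    assume "x \<in> ncone \<beta> (insert (a + b) (insert a B))"
      "x \<in> ncone (\<beta> + b) (insert (a + b) (insert b B))"
    then obtain y i j z k l where y: "y \<in> ncone \<beta> B" "x = y + of_nat (i + j) *s a + of_nat j *s b"
      and z: "z \<in> ncone \<beta> B" "x = z + of_nat k *s a + of_nat (Suc (k + l)) *s b"
      using L R by metis
    have mem: "y + of_nat (i + j) *s a \<in> ncone \<beta> (insert a B)"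
      "y + of_nat j *s b \<in> ncone \<beta> (insert b B)"
      "z + of_nat k *s a \<in> ncone \<beta> (insert a B)"
      "z + of_nat (Suc (k + l)) *s b \<in> ncone \<beta> (insert b B)"
      using ncone_insert[OF assms(1,3)] ncone_insert[OF assms(1,4)] y(1) z(1) by blast+
    have eq: "y + of_nat (i + j) *s a + of_nat j *s b =
        z + of_nat k *s a + of_nat (Suc (k + l)) *s b"
      using y(2) z(2) by (rule subst)
    then have eq': "y + of_nat j *s b + of_nat (i + j) *s a =
        z + of_nat (Suc (k + l)) *s b + of_nat k *s a"
      by (simp only: add_ac)
    have "of_nat j = (of_nat (Suc (k + l)) :: rat)"
      by (rule ncone_coeff_unique[OF ind(1) _ mem(1,3) eq]) (use assms(2,4) in blast)
    moreover have "of_nat (i + j) = (of_nat k :: rat)"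
      by (rule ncone_coeff_unique[OF ind(2) _ mem(2,4) eq']) (use assms(2,3) in blast)
    ultimately have "j = Suc (k + l)" "i + j = k"
      using of_nat_eq_iff by blast+
    then show False by simp
  qed
  ultimately show ?thesis
    using splits_Un assms(6,7) by metis
qed

section \<open>Half-spaces and integrality conditions are tame\<close>

lemma additive_scale:
  fixes h :: "rat^'d \<Rightarrow> rat"
  assumes "additive h"
  shows "h (of_nat k *s x) = of_nat k * h x"
proof -
  interpret h: additive h by fact
  show ?thesis
    by (induction k) (simp_all add: h.zero h.add vec.scale_left_distrib algebra_simps)
qed

lemma additive_ncone:
  fixes h :: "rat^'d \<Rightarrow> rat"
  assumes "additive h" "x \<in> ncone \<beta> B"
  obtains c :: "rat^'d \<Rightarrow> nat" where "h x = h \<beta> + (\<Sum>b\<in>B. of_nat (c b) * h b)"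
proof -
  interpret h: additive h by fact
  from assms(2) obtain c where "x = \<beta> + (\<Sum>b\<in>B. of_nat (c b) *s b)"
    by (auto simp: ncone_def)
  then show ?thesis
    by (intro that[of c]) (simp add: h.add h.sum additive_scale[OF assms(1)])
qed

lemma remove_generator:
  assumes "finite B" "B \<subseteq> nat_vecs" "vec.independent B" "b \<in> B"
  obtains B' where "B = insert b B'" "b \<notin> B'" "finite B'" "B' \<subseteq> nat_vecs"
    "vec.independent B'" "b \<in> nat_vecs"
proof (rule that[of "B - {b}"])
  show "vec.independent (B - {b})"
    using assms(3) by (rule vec.independent_mono) auto
qed (use assms in auto)

text \<open>
If the linear form \<open>h\<close> never decreases along the generators, then a cone whose apex lies in the
half-space is contained in it. Otherwise, a generator \<open>b\<close> with \<open>h b = L\<close> is split off: the face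
has fewer generators on which \<open>h\<close> does not vanish, and the apex of the translate is closer to
the half-space by \<open>L\<close>.
\<close>
lemma splits_halfspace_nonneg:
  fixes h :: "rat^'d \<Rightarrow> rat"
  assumes h: "additive h"
    and L: "L > 0"
    and B: "finite B" "B \<subseteq> nat_vecs" "vec.independent B" "\<beta> \<in> nat_vecs"
    and hB: "\<And>b. b \<in> B \<Longrightarrow> h b \<in> {0, L}"
  shows "splits {x. c \<le> h x} (ncone \<beta> B)"
  using B hB
proof (induction "card {b \<in> B. h b \<noteq> 0}" arbitrary: \<beta> B rule: less_induct)
  case (less B)
  interpret h: additive h by fact
  have nn: "h b \<ge> 0" if "b \<in> B" for b
    using less.prems(5) that L by force
  have base: "splits {x. c \<le> h x} (ncone \<beta> B)" if "c \<le> h \<beta>" "\<beta> \<in> nat_vecs" for \<beta>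
  proof (rule splits_trivial)
    have "c \<le> h x" if x: "x \<in> ncone \<beta> B" for x
    proof -
      obtain k :: "rat^'d \<Rightarrow> nat" where "h x = h \<beta> + (\<Sum>b\<in>B. of_nat (k b) * h b)"
        using additive_ncone[OF h x] .
      moreover have "(\<Sum>b\<in>B. of_nat (k b) * h b) \<ge> 0"
        by (intro sum_nonneg mult_nonneg_nonneg) (use nn in auto)
      ultimately show ?thesis using \<open>c \<le> h \<beta>\<close> by simp
    qed
    then show "ncone \<beta> B \<subseteq> {x. c \<le> h x} \<or> ncone \<beta> B \<inter> {x. c \<le> h x} = {}"
      by auto
  qed (use less.prems that in \<open>auto intro: simplicialI\<close>)
  show ?case
  proof (cases "\<exists>b\<in>B. h b \<noteq> 0")
    case False
    show ?thesis
    proof (rule splits_trivial)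
      have "h x = h \<beta>" if "x \<in> ncone \<beta> B" for x
        using additive_ncone[OF h that] False by (metis (no_types, lifting) add.right_neutral
            mult_zero_right sum.neutral)
      then show "ncone \<beta> B \<subseteq> {x. c \<le> h x} \<or> ncone \<beta> B \<inter> {x. c \<le> h x} = {}"
        by (cases "c \<le> h \<beta>") auto
    qed (use less.prems in \<open>auto intro: simplicialI\<close>)
  next
    case True
    then obtain b where b: "b \<in> B" "h b = L"
      using less.prems(5) by force
    obtain B' where B': "B = insert b B'" "b \<notin> B'" "finite B'" "B' \<subseteq> nat_vecs"
      "vec.independent B'" "b \<in> nat_vecs"
      using remove_generator[OF less.prems(1-3) b(1)] .
    have "{b \<in> B'. h b \<noteq> 0} \<subset> {b \<in> B. h b \<noteq> 0}"
      using B' b L by auto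
    then have IH: "splits {x. c \<le> h x} (ncone \<beta> B')" if "\<beta> \<in> nat_vecs" for \<beta>
      using less.hyps[of B' \<beta>] less.prems B' that by (simp add: psubset_card_mono)
    obtain n :: nat where "(c - h \<beta>) / L \<le> of_nat n"
      using real_arch_simple by blast
    then have "c \<le> h \<beta> + of_nat n * L"
      using L by (simp add: field_simps)
    then show ?thesis
      using less.prems(4)
    proof (induction n arbitrary: \<beta>)
      case 0
      then show ?case by (intro base) auto
    next
      case (Suc n)
      have "splits {x. c \<le> h x} (ncone (\<beta> + b) B)"
        using Suc B' b by (intro Suc.IH) (auto simp: h.add algebra_simps nat_vecs_add)
      then show ?case
        using IH[OF Suc.prems(2)] B' less.prems(3) splits_face by metis
    qed
  qed
qed

text \<open>
The mirror image: a cone with apex outside the half-space stays outside, and the translates move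
their apex towards the outside.
\<close>
lemma splits_halfspace_nonpos:
  fixes h :: "rat^'d \<Rightarrow> rat"
  assumes h: "additive h"
    and L: "L > 0"
    and B: "finite B" "B \<subseteq> nat_vecs" "vec.independent B" "\<beta> \<in> nat_vecs"
    and hB: "\<And>b. b \<in> B \<Longrightarrow> h b \<in> {0, - L}"
  shows "splits {x. c \<le> h x} (ncone \<beta> B)"
  using B hB
proof (induction "card {b \<in> B. h b \<noteq> 0}" arbitrary: \<beta> B rule: less_induct)
  case (less B)
  interpret h: additive h by fact
  have np: "h b \<le> 0" if "b \<in> B" for b
    using less.prems(5) that L by force
  have base: "splits {x. c \<le> h x} (ncone \<beta> B)" if "h \<beta> < c" "\<beta> \<in> nat_vecs" for \<beta>
  proof (rule splits_trivial)
    have "h x < c" if x: "x \<in> ncone \<beta> B" for x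
    proof -
      obtain k :: "rat^'d \<Rightarrow> nat" where "h x = h \<beta> + (\<Sum>b\<in>B. of_nat (k b) * h b)"
        using additive_ncone[OF h x] .
      moreover have "(\<Sum>b\<in>B. of_nat (k b) * h b) \<le> 0"
        by (intro sum_nonpos mult_nonneg_nonpos) (use np in auto)
      ultimately show ?thesis using \<open>h \<beta> < c\<close> by simp
    qed
    then show "ncone \<beta> B \<subseteq> {x. c \<le> h x} \<or> ncone \<beta> B \<inter> {x. c \<le> h x} = {}"
      by force
  qed (use less.prems that in \<open>auto intro: simplicialI\<close>)
  show ?case
  proof (cases "\<exists>b\<in>B. h b \<noteq> 0")
    case False
    then show ?thesis
      using less.prems by (intro splits_halfspace_nonneg[OF h L]) auto
  next
    case True
    then obtain b where b: "b \<in> B" "h b = - L"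
      using less.prems(5) by force
    obtain B' where B': "B = insert b B'" "b \<notin> B'" "finite B'" "B' \<subseteq> nat_vecs"
      "vec.independent B'" "b \<in> nat_vecs"
      using remove_generator[OF less.prems(1-3) b(1)] .
    have "{b \<in> B'. h b \<noteq> 0} \<subset> {b \<in> B. h b \<noteq> 0}"
      using B' b L by auto
    then have IH: "splits {x. c \<le> h x} (ncone \<beta> B')" if "\<beta> \<in> nat_vecs" for \<beta>
      using less.hyps[of B' \<beta>] less.prems B' that by (simp add: psubset_card_mono)
    obtain n :: nat where "(h \<beta> - c) / L < of_nat n"
      using reals_Archimedean2 by blast
    then have "h \<beta> - of_nat n * L < c"
      using L by (simp add: field_simps)
    then show ?thesis
      using less.prems(4)
    proof (induction n arbitrary: \<beta>)
      case 0
      then show ?case by (intro base) auto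
    next
      case (Suc n)
      have "splits {x. c \<le> h x} (ncone (\<beta> + b) B)"
        using Suc B' b by (intro Suc.IH) (auto simp: h.add algebra_simps nat_vecs_add)
      then show ?case
        using IH[OF Suc.prems(2)] B' less.prems(3) splits_face by metis
    qed
  qed
qed

text \<open>
Generators \<open>a\<close> and \<open>b\<close> with \<open>h a = L\<close> and \<open>h b = - L\<close> cancel: after a stellar subdivision each part
contains \<open>a + b\<close>, on which \<open>h\<close> vanishes, in place of one of them. So the number of generators on
which \<open>h\<close> does not vanish drops until all remaining signs agree.
\<close>
lemma splits_halfspace_balanced:
  fixes h :: "rat^'d \<Rightarrow> rat"
  assumes h: "additive h"
    and L: "L > 0"
    and B: "finite B" "B \<subseteq> nat_vecs" "vec.independent B" "\<beta> \<in> nat_vecs"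
    and hB: "\<And>b. b \<in> B \<Longrightarrow> h b \<in> {0, L, - L}"
  shows "splits {x. c \<le> h x} (ncone \<beta> B)"
  using B hB
proof (induction "card {b \<in> B. h b \<noteq> 0}" arbitrary: \<beta> B rule: less_induct)
  case (less B)
  interpret h: additive h by fact
  consider "\<forall>b\<in>B. h b \<in> {0, L}" | "\<forall>b\<in>B. h b \<in> {0, - L}"
    | a b where "a \<in> B" "b \<in> B" "h a = L" "h b = - L"
    using less.prems(5) by blast
  then show ?case
  proof cases
    case 3
    have "a \<noteq> b" using 3 L by auto
    obtain B1 where B1: "B = insert a B1" "a \<notin> B1" "finite B1" "B1 \<subseteq> nat_vecs"
      "vec.independent B1" "a \<in> nat_vecs"
      using remove_generator[OF less.prems(1-3) 3(1)] .
    have "b \<in> B1" using 3 B1 \<open>a \<noteq> b\<close> by auto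
    then obtain C where C: "B1 = insert b C" "b \<notin> C" "finite C" "C \<subseteq> nat_vecs"
      "vec.independent C" "b \<in> nat_vecs"
      using remove_generator[OF B1(3-5)] by blast
    have B: "B = insert a (insert b C)" "a \<notin> C"
      using B1 C by auto
    have ind: "vec.independent (insert a (insert b C))" "vec.independent (insert b (insert a C))"
      using less.prems(3) B by (simp_all add: insert_commute)
    note shear = independent_shear[OF ind(1) \<open>a \<noteq> b\<close> B(2) C(2)]
      independent_shear[OF ind(2) \<open>a \<noteq> b\<close>[symmetric] C(2) B(2), unfolded add.commute[of b a]]
    have h0: "h (a + b) = 0"
      using 3 by (simp add: h.add)
    have vecs: "a \<in> nat_vecs" "a + b \<in> nat_vecs"
      using B1(6) C(6) by (auto intro: nat_vecs_add)
    have signs: "h x \<in> {0, L, - L}" if "x \<in> insert a (insert b C)" for x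
      using less.prems(5) that B(1) by blast
    have step: "splits {x. c \<le> h x} (ncone \<gamma> (insert (a + b) (insert e C)))"
      if e: "e \<in> {a, b}" "vec.independent (insert (a + b) (insert e C))" "\<gamma> \<in> nat_vecs" for \<gamma> e
    proof (rule less.hyps)
      obtain f where f: "f \<in> {a, b}" "f \<noteq> e"
        using \<open>a \<noteq> b\<close> by blast
      have "h a \<noteq> 0" "h b \<noteq> 0"
        using 3 L by auto
      then have "f \<in> {x \<in> B. h x \<noteq> 0}" "f \<notin> {x \<in> insert (a + b) (insert e C). h x \<noteq> 0}"
        using f h0 B C(2) by auto
      moreover have "{x \<in> insert (a + b) (insert e C). h x \<noteq> 0} \<subseteq> {x \<in> B. h x \<noteq> 0}"
        using e(1) h0 B(1) by blast
      ultimately show "card {x \<in> insert (a + b) (insert e C). h x \<noteq> 0} < card {x \<in> B. h x \<noteq> 0}"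
        using less.prems(1) by (intro psubset_card_mono) auto
      show "h x \<in> {0, L, - L}" if "x \<in> insert (a + b) (insert e C)" for x
        using that e(1) h0 signs by blast
      show "insert (a + b) (insert e C) \<subseteq> nat_vecs"
        using e(1) vecs C(4,6) by blast
    qed (use e C(3) in simp_all)
    have "splits {x. c \<le> h x} (ncone \<beta> (insert (a + b) (insert a C)))"
      using shear(4) less.prems(4) by (intro step) auto
    moreover have "splits {x. c \<le> h x} (ncone (\<beta> + b) (insert (a + b) (insert b C)))"
      using shear(2) less.prems(4) C(6) by (intro step) (auto intro: nat_vecs_add)
    ultimately show ?thesis
      using splits_subdivide[OF C(3) \<open>a \<noteq> b\<close> B(2) C(2) ind(1)] B(1) by simp
  next
    case 1
    show ?thesis
      by (rule splits_halfspace_nonneg[OF h L less.prems(1-4)]) (use 1 in blast)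
  next
    case 2
    show ?thesis
      by (rule splits_halfspace_nonpos[OF h L less.prems(1-4)]) (use 2 in blast)
  qed
qed

text \<open>
Generators can be replaced by multiples with a desirable property, one at a time and with
arbitrary apex, since \<open>splits_residue\<close> changes only the apex and one generator.
\<close>
lemma splits_refine:
  assumes "\<And>\<beta> B. \<beta> \<in> nat_vecs \<Longrightarrow> finite B \<Longrightarrow> B \<subseteq> nat_vecs \<Longrightarrow> vec.independent B \<Longrightarrow>
      (\<And>b. b \<in> B \<Longrightarrow> good b) \<Longrightarrow> splits X (ncone \<beta> B)"
    and "\<beta> \<in> nat_vecs" "finite B" "B \<subseteq> nat_vecs" "vec.independent B"
    and "\<And>b. b \<in> B \<Longrightarrow> \<exists>k>0. good (of_nat k *s b)"
  shows "splits X (ncone \<beta> B)"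
proof -
  have "splits X (ncone \<beta> B)"
    if "\<beta> \<in> nat_vecs" "finite B" "B \<subseteq> nat_vecs" "vec.independent B"
      "\<And>b. b \<in> B \<Longrightarrow> good b \<or> (\<exists>k>0. good (of_nat k *s b))"
    for \<beta> B
    using that
  proof (induction "card {b \<in> B. \<not> good b}" arbitrary: \<beta> B rule: less_induct)
    case (less B)
    show ?case
    proof (cases "\<forall>b\<in>B. good b")
      case True
      then show ?thesis using assms(1) less.prems by blast
    next
      case False
      then obtain b k where b: "b \<in> B" "\<not> good b" "k > 0" "good (of_nat k *s b)"
        using less.prems(5) by blast
      obtain B' where B': "B = insert b B'" "b \<notin> B'" "finite B'" "B' \<subseteq> nat_vecs"
        "vec.independent B'" "b \<in> nat_vecs"
        using remove_generator[OF less.prems(2-4) b(1)] .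
      let ?B = "insert (of_nat k *s b) B'"
      have "of_nat k *s b \<notin> vec.span B'"
        using less.prems(4) B'(1,2) b(3) by (intro multiple_notin_span) auto
      then have ind: "vec.independent ?B"
        using B'(5) by (rule vec.independent_insertI)
      have "b \<notin> {x \<in> ?B. \<not> good x}" "b \<in> {x \<in> B. \<not> good x}"
        using b B' by auto
      moreover have "{x \<in> ?B. \<not> good x} \<subseteq> {x \<in> B. \<not> good x}"
        using b B' by auto
      ultimately have "{x \<in> ?B. \<not> good x} \<subset> {x \<in> B. \<not> good x}"
        by blast
      then have "card {x \<in> ?B. \<not> good x} < card {x \<in> B. \<not> good x}"
        by (rule psubset_card_mono[rotated]) (use less.prems in auto)
      then have "splits X (ncone (\<beta> + of_nat \<rho> *s b) ?B)" for \<rho>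
        by (rule less.hyps) (use less.prems B' b ind in \<open>auto intro: nat_vecs_add nat_vecs_scale\<close>)
      then show ?thesis
        using splits_residue[of B' b k X \<beta>] B' less.prems(4) b(3) by blast
    qed
  qed
  then show ?thesis
    using assms(2-) by blast
qed

text \<open>
To reach the balanced situation, every generator \<open>b\<close> with \<open>h b \<noteq> 0\<close> is scaled so that
\<open>\<bar>h b\<bar> = L\<close>, where \<open>L\<close> is a common multiple of the numerators of all these values.
\<close>
lemma tame_halfspace:
  fixes h :: "rat^'d \<Rightarrow> rat"
  assumes h: "additive h"
  shows "tame {x. c \<le> h x}"
  unfolding tame_def
proof (intro allI impI)
  fix K :: "(rat^'d) set"
  assume "simplicial K"
  then obtain \<beta> B where K: "\<beta> \<in> nat_vecs" "B \<subseteq> nat_vecs" "finite B" "vec.independent B"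
    "K = ncone \<beta> B"
    by (auto simp: simplicial_def)
  define num where "num b = nat \<bar>fst (quotient_of (h b))\<bar>" for b
  define den where "den b = nat (snd (quotient_of (h b)))" for b
  have den: "den b > 0" for b
    using quotient_of_denom_pos'[of "h b"] by (simp add: den_def)
  have abs_h: "\<bar>h b\<bar> = of_nat (num b) / of_nat (den b)" for b
  proof -
    obtain n d where q: "quotient_of (h b) = (n, d)"
      by force
    show ?thesis
      unfolding num_def den_def q using quotient_of_div[OF q] quotient_of_denom_pos[OF q] by simp
  qed
  define Z where "Z = {b \<in> B. h b \<noteq> 0}"
  \<comment> \<open>Zero values of \<open>h\<close> are left out, since they would make the product vanish.\<close>
  define L where "L = (\<Prod>b\<in>Z. num b)"
  have num: "num b > 0" if "b \<in> Z" for b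
    using abs_h[of b] that by (cases "num b = 0") (auto simp: Z_def)
  have "L > 0"
    using num by (auto simp: L_def intro: prod_pos)
  have "\<exists>k>0. h (of_nat k *s b) \<in> {0, of_nat L, - of_nat L}" if "b \<in> B" for b
  proof (cases "b \<in> Z")
    case True
    then have "L = num b * (\<Prod>b\<in>Z - {b}. num b)"
      using K(3) by (simp add: L_def Z_def prod.remove)
    then obtain q where q: "L = num b * q" by blast
    then have "q > 0" using \<open>L > 0\<close> by auto
    have "\<bar>h (of_nat (den b * q) *s b)\<bar> = of_nat L"
      using den[of b] by (simp only: additive_scale[OF h] abs_mult abs_h) (simp add: q)
    then have "h (of_nat (den b * q) *s b) \<in> {0, of_nat L, - of_nat L}"
      by (auto simp: abs_if split: if_splits)
    then show ?thesis
      using den[of b] \<open>q > 0\<close> by (intro exI[of _ "den b * q"]) simp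
  next
    case False
    then have "h (of_nat 1 *s b) = 0"
      using that by (simp add: Z_def)
    then show ?thesis by (intro exI[of _ 1]) simp
  qed
  note multiple = this
  have pos: "(0::rat) < of_nat L"
    using \<open>L > 0\<close> by simp
  show "splits {x. c \<le> h x} K"
    unfolding K(5)
  proof (rule splits_refine[where good = "\<lambda>b. h b \<in> {0, of_nat L, - of_nat L}"])
    show "splits {x. c \<le> h x} (ncone \<gamma> C)"
      if "\<gamma> \<in> nat_vecs" "finite C" "C \<subseteq> nat_vecs" "vec.independent C"
        "\<And>b. b \<in> C \<Longrightarrow> h b \<in> {0, of_nat L, - of_nat L}" for \<gamma> C
      using that(2,3,4,1,5) by (rule splits_halfspace_balanced[OF h pos])
  qed (fact K multiple)+
qed

text \<open>
Multiplying each generator \<open>b\<close> by the denominator of \<open>h b\<close> makes \<open>h\<close> constant modulo \<open>\<int>\<close> on each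
of the resulting cones.
\<close>
lemma tame_integral:
  fixes h :: "rat^'d \<Rightarrow> rat"
  assumes h: "additive h"
  shows "tame {x. h x - c \<in> \<int>}"
  unfolding tame_def
proof (intro allI impI)
  fix K :: "(rat^'d) set"
  assume "simplicial K"
  then obtain \<beta> B where K: "\<beta> \<in> nat_vecs" "B \<subseteq> nat_vecs" "finite B" "vec.independent B"
    "K = ncone \<beta> B"
    by (auto simp: simplicial_def)
  have "\<exists>k>0. h (of_nat k *s b) \<in> \<int>" for b
  proof -
    obtain n d where q: "quotient_of (h b) = (n, d)"
      by force
    then have "d > 0"
      by (rule quotient_of_denom_pos)
    then have "of_nat (nat d) * h b = of_int n"
      using quotient_of_div[OF q] by simp
    then have "h (of_nat (nat d) *s b) \<in> \<int>"
      by (simp add: additive_scale[OF h])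
    then show ?thesis
      using \<open>d > 0\<close> by (intro exI[of _ "nat d"]) simp
  qed
  note multiple = this
  have base: "splits {x. h x - c \<in> \<int>} (ncone \<beta> B)"
    if "\<beta> \<in> nat_vecs" "finite B" "B \<subseteq> nat_vecs" "vec.independent B" "\<And>b. b \<in> B \<Longrightarrow> h b \<in> \<int>"
    for \<beta> B
  proof (rule splits_trivial)
    have "h x - c \<in> \<int> \<longleftrightarrow> h \<beta> - c \<in> \<int>" if x: "x \<in> ncone \<beta> B" for x
    proof -
      obtain k :: "rat^'d \<Rightarrow> nat" where k: "h x = h \<beta> + (\<Sum>b\<in>B. of_nat (k b) * h b)"
        using additive_ncone[OF h x] .
      have "(\<Sum>b\<in>B. of_nat (k b) * h b) \<in> \<int>"
        using \<open>\<And>b. b \<in> B \<Longrightarrow> h b \<in> \<int>\<close> by (intro Ints_sum Ints_mult) auto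
      then have "(h \<beta> - c) + (\<Sum>b\<in>B. of_nat (k b) * h b) \<in> \<int> \<longleftrightarrow> h \<beta> - c \<in> \<int>"
        by (metis Ints_add Ints_diff add_diff_cancel_right')
      then show ?thesis
        by (simp add: k algebra_simps)
    qed
    then show "ncone \<beta> B \<subseteq> {x. h x - c \<in> \<int>} \<or> ncone \<beta> B \<inter> {x. h x - c \<in> \<int>} = {}"
      by (cases "h \<beta> - c \<in> \<int>") auto
  qed (use that in \<open>auto intro: simplicialI\<close>)
  show "splits {x. h x - c \<in> \<int>} K"
    unfolding K(5) by (rule splits_refine[where good = "\<lambda>b. h b \<in> \<int>"]) (fact base K | rule multiple)+
qed

lemma tame_level:
  fixes h :: "rat^'d \<Rightarrow> rat"
  assumes h: "additive h"
  shows "tame {x. h x = c}"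
proof -
  interpret h: additive h by fact
  have "additive (\<lambda>x. - h x)"
    by standard (simp add: h.add)
  then have "tame ({x. c \<le> h x} \<inter> {x. - c \<le> - h x})"
    using h by (intro tame_Int tame_halfspace)
  moreover have "{x. c \<le> h x} \<inter> {x. - c \<le> - h x} = {x. h x = c}"
    by auto
  ultimately show ?thesis by simp
qed

section \<open>Finitely generated affine monoids are tame\<close>

text \<open>
With respect to a basis of \<open>\<rat>\<^sup>d\<close> extending \<open>B\<close>, the points of \<open>\<beta> + \<langle>B\<rangle>\<close> are those whose coordinates
relative to \<open>\<beta>\<close> are nonnegative integers on \<open>B\<close> and zero on the other basis vectors.
\<close>

lemma tame_simplicial:
  fixes \<beta> :: "rat^'d"
  assumes "vec.independent B"
  shows "tame (ncone \<beta> B)"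
proof -
  define E where "E = vec.extend_basis B"
  have E: "B \<subseteq> E" "vec.independent E" "vec.span E = UNIV"
    using assms by (auto simp: E_def vec.extend_basis_superset vec.independent_extend_basis
        vec.span_extend_basis)
  then have "finite E" "finite B"
    using vec.finiteI_independent assms by blast+
  define h where "h b x = vec.representation E x b" for b x
  have h: "additive (h b)" for b
    by standard (simp add: h_def vec.representation_add E)
  have diff: "h b (x - y) = h b x - h b y" for b x y
    using additive.diff[OF h] .
  have basis: "(\<Sum>b\<in>E. h b x *s b) = x" for x
    unfolding h_def using E \<open>finite E\<close> by (intro vec.sum_representation_eq) auto
  have coord: "h b (\<Sum>b\<in>B. of_nat (c b) *s b) = (if b \<in> B then of_nat (c b) else 0)"
    for c :: "rat^'d \<Rightarrow> nat" and b
  proof -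
    have "h b (\<Sum>b\<in>B. of_nat (c b) *s b) = (\<Sum>b'\<in>B. of_nat (c b') * h b b')"
      by (simp add: additive.sum[OF h] additive_scale[OF h])
    also have "\<dots> = (\<Sum>b'\<in>B. if b' = b then of_nat (c b) else 0)"
      using E by (intro sum.cong) (auto simp: h_def vec.representation_basis subset_iff)
    finally show ?thesis using \<open>finite B\<close> by simp
  qed
  have eq: "ncone \<beta> B = (\<Inter>b\<in>B. {x. h b \<beta> \<le> h b x} \<inter> {x. h b x - h b \<beta> \<in> \<int>}) \<inter>
      (\<Inter>b\<in>E - B. {x. h b x = h b \<beta>})" (is "_ = ?R")
  proof (intro set_eqI iffI)
    fix x assume "x \<in> ncone \<beta> B"
    then obtain c where "x - \<beta> = (\<Sum>b\<in>B. of_nat (c b) *s b)"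
      by (auto simp: ncone_def)
    then have "h b x - h b \<beta> = (if b \<in> B then of_nat (c b) else 0)" for b
      using coord[of b c] diff by metis
    then have "h b x = h b \<beta> + (if b \<in> B then of_nat (c b) else 0)" for b
      by (simp add: algebra_simps)
    then show "x \<in> ?R"
      by auto
  next
    fix x assume x: "x \<in> ?R"
    define c where "c b = nat \<lfloor>h b x - h b \<beta>\<rfloor>" for b
    have c: "h b x - h b \<beta> = of_nat (c b)" if "b \<in> B" for b
      using x that by (auto simp: c_def elim!: Ints_cases)
    have "x - \<beta> = (\<Sum>b\<in>E. h b (x - \<beta>) *s b)"
      using basis[of "x - \<beta>"] by simp
    also have "\<dots> = (\<Sum>b\<in>B. h b (x - \<beta>) *s b)"
      using x E(1) \<open>finite E\<close> by (intro sum.mono_neutral_right) (auto simp: diff)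
    also have "\<dots> = (\<Sum>b\<in>B. of_nat (c b) *s b)"
      by (intro sum.cong) (auto simp: diff c)
    finally have "x = \<beta> + (\<Sum>b\<in>B. of_nat (c b) *s b)"
      by (simp add: algebra_simps)
    then show "x \<in> ncone \<beta> B"
      unfolding ncone_def by blast
  qed
  show ?thesis
    unfolding eq using \<open>finite E\<close> \<open>finite B\<close>
    by (intro tame_Int tame_INT tame_halfspace tame_integral tame_level h) auto
qed

lemma int_relation:
  fixes G :: "(rat^'d) set"
  assumes "finite G" "vec.dependent G"
  obtains z :: "rat^'d \<Rightarrow> int" and p where "(\<Sum>g\<in>G. of_int (z g) *s g) = 0" "p \<in> G" "z p > 0"
proof -
  obtain u v where u: "(\<Sum>g\<in>G. u g *s g) = 0" "v \<in> G" "u v \<noteq> 0"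
    using assms by (auto simp: vec.dependent_finite)
  define D where "D = (\<Prod>g\<in>G. snd (quotient_of (u g)))"
  have den: "snd (quotient_of (u g)) > 0" for g
    using quotient_of_denom_pos' .
  then have "D > 0"
    by (simp add: D_def prod_pos)
  have "of_int D * u g \<in> \<int>" if "g \<in> G" for g
  proof -
    have "D = snd (quotient_of (u g)) * (\<Prod>g\<in>G - {g}. snd (quotient_of (u g)))"
      using assms(1) that by (simp add: D_def prod.remove)
    then obtain q where q: "D = snd (quotient_of (u g)) * q" by blast
    have "u g = of_int (fst (quotient_of (u g))) / of_int (snd (quotient_of (u g)))"
      by (rule quotient_of_div) simp
    then have "of_int D * u g = of_int (fst (quotient_of (u g)) * q)"
      using den[of g] q by (simp add: field_simps)
    then show ?thesis by simp
  qed
  then have "\<forall>g\<in>G. \<exists>n. of_int D * u g = of_int n"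
    by (auto elim: Ints_cases)
  then obtain z where "\<forall>g\<in>G. of_int D * u g = of_int (z g)"
    by (rule bchoice[THEN exE])
  then have z: "of_int (z g) = of_int D * u g" if "g \<in> G" for g
    using that by simp
  have "(\<Sum>g\<in>G. of_int (z g) *s g) = of_int D *s (\<Sum>g\<in>G. u g *s g)"
    unfolding vec.scale_sum_right by (intro sum.cong) (auto simp: z)
  then have rel: "(\<Sum>g\<in>G. of_int (z g) *s g) = 0"
    by (simp add: u)
  have "z v \<noteq> 0"
    using z[OF u(2)] u(3) \<open>D > 0\<close> by auto
  then consider "z v > 0" | "- z v > 0" by linarith
  then show ?thesis
  proof cases
    case 1
    with rel u(2) that show ?thesis by blast
  next
    case 2
    have "(\<Sum>g\<in>G. of_int (- z g) *s g) = 0"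
      using rel by (simp add: sum_negf)
    with 2 u(2) that[of "\<lambda>g. - z g"] show ?thesis by blast
  qed
qed

text \<open>
A discrete form of Caratheodory's theorem. Subtracting an integral relation with a positive
coefficient from a coefficient vector does not change the represented point. This can be repeated
until some coefficient \<open>c p\<close> with \<open>z p > 0\<close> is smaller than \<open>z p\<close>; the generator \<open>p\<close> is then used only
boundedly often and can be moved into the apex.
\<close>
lemma ncone_reduce:
  fixes z :: "rat^'d \<Rightarrow> int"
  assumes G: "finite G" and z: "(\<Sum>g\<in>G. of_int (z g) *s g) = 0" "p \<in> G" "z p > 0"
  shows "ncone \<beta> G = (\<Union>p\<in>{p \<in> G. z p > 0}. \<Union>\<rho>\<in>{..<nat (z p)}.
    ncone (\<beta> + of_nat \<rho> *s p) (G - {p}))"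
proof -
  let ?P = "{p \<in> G. z p > 0}"
  have mem: "x \<in> ncone (\<beta> + of_nat \<rho> *s p) (G - {p}) \<longleftrightarrow>
      (\<exists>y\<in>ncone \<beta> (G - {p}). x = y + of_nat \<rho> *s p)" for x \<rho> p
    by (auto simp: ncone_shift algebra_simps intro!: bexI[of _ "x - of_nat \<rho> *s p"])
  have small: "\<exists>c'. (\<Sum>g\<in>G. of_nat (c' g) *s g) = (\<Sum>g\<in>G. of_nat (c g) *s g) \<and>
      (\<exists>p\<in>?P. c' p < nat (z p))" for c :: "rat^'d \<Rightarrow> nat"
  proof (induction "\<Sum>g\<in>?P. c g" arbitrary: c rule: less_induct)
    case less
    show ?case
    proof (cases "\<exists>p\<in>?P. c p < nat (z p)")
      case False
      \<comment> \<open>Truncation to a natural number is harmless: the difference is nonnegative on all of \<open>G\<close>.\<close>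
      define c' where "c' g = nat (int (c g) - z g)" for g
      have c': "int (c' g) = int (c g) - z g" if "g \<in> G" for g
        using False that by (force simp: c'_def)
      have "(of_nat (c' g) :: rat) = of_nat (c g) - of_int (z g)" if "g \<in> G" for g
        using c'[OF that] by (metis of_int_diff of_int_of_nat_eq)
      then have "(\<Sum>g\<in>G. of_nat (c' g) *s g) = (\<Sum>g\<in>G. of_nat (c g) *s g - of_int (z g) *s g)"
        by (intro sum.cong) (auto simp: vec.scale_left_diff_distrib)
      then have eq: "(\<Sum>g\<in>G. of_nat (c' g) *s g) = (\<Sum>g\<in>G. of_nat (c g) *s g)"
        using z(1) by (simp add: sum_subtractf)
      have lt: "c' g < c g" if "g \<in> ?P" for g
        using c'[of g] that by auto
      have "(\<Sum>g\<in>?P. c' g) < (\<Sum>g\<in>?P. c g)"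
        using G z(2,3) by (intro sum_strict_mono lt) auto
      from less[OF this] show ?thesis
        by (simp only: eq)
    qed auto
  qed
  show ?thesis
  proof (intro set_eqI iffI)
    fix x assume "x \<in> ncone \<beta> G"
    then obtain c where c: "x = \<beta> + (\<Sum>g\<in>G. of_nat (c g) *s g)"
      by (auto simp: ncone_def)
    obtain c' q where c': "x = \<beta> + (\<Sum>g\<in>G. of_nat (c' g) *s g)" "q \<in> ?P" "c' q < nat (z q)"
      using small[of c] unfolding c by metis
    then have "x = (\<beta> + (\<Sum>g\<in>G - {q}. of_nat (c' g) *s g)) + of_nat (c' q) *s q"
      using G c'(2) by (simp add: sum.remove[of G q] algebra_simps)
    then have "x \<in> ncone (\<beta> + of_nat (c' q) *s q) (G - {q})"
      unfolding mem unfolding ncone_def by blast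
    with c' show "x \<in> (\<Union>p\<in>?P. \<Union>\<rho>\<in>{..<nat (z p)}. ncone (\<beta> + of_nat \<rho> *s p) (G - {p}))"
      by blast
  next
    fix x assume "x \<in> (\<Union>p\<in>?P. \<Union>\<rho>\<in>{..<nat (z p)}. ncone (\<beta> + of_nat \<rho> *s p) (G - {p}))"
    then obtain q \<rho> y where q: "q \<in> G" "y \<in> ncone \<beta> (G - {q})" "x = y + of_nat \<rho> *s q"
      using mem by blast
    then have "x \<in> ncone \<beta> (insert q (G - {q}))"
      using G by (subst ncone_insert) auto
    with q(1) show "x \<in> ncone \<beta> G"
      by (simp add: insert_absorb)
  qed
qed

lemma tame_ncone:
  assumes "finite G"
  shows "tame (ncone \<beta> G)"
  using assms
proof (induction "card G" arbitrary: G \<beta> rule: less_induct)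
  case less
  show ?case
  proof (cases "vec.dependent G")
    case True
    obtain z p where z: "(\<Sum>g\<in>G. of_int (z g) *s g) = 0" "p \<in> G" "z p > 0"
      using int_relation[OF less.prems True] .
    have "tame (ncone \<gamma> (G - {q}))" if "q \<in> G" for \<gamma> q
      using less.prems that by (intro less.hyps card_Diff1_less) auto
    then show ?thesis
      unfolding ncone_reduce[OF less.prems z]
      using less.prems by (intro tame_UN) auto
  qed (rule tame_simplicial)
qed

text \<open>
Cones over a family of generators, in which repetitions are possible, are cones over its range.
\<close>
lemma ncone_family:
  fixes g :: "'i \<Rightarrow> rat^'d"
  assumes "finite I"
  shows "{\<beta> + (\<Sum>i\<in>I. of_nat (c i) *s g i) | c :: 'i \<Rightarrow> nat. True} = ncone \<beta> (g ` I)"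
proof (intro set_eqI iffI)
  fix x assume "x \<in> {\<beta> + (\<Sum>i\<in>I. of_nat (c i) *s g i) | c :: 'i \<Rightarrow> nat. True}"
  then obtain c where x: "x = \<beta> + (\<Sum>i\<in>I. of_nat (c i) *s g i)"
    by auto
  have "(\<Sum>i\<in>I. of_nat (c i) *s g i) = (\<Sum>y\<in>g ` I. \<Sum>i\<in>{i \<in> I. g i = y}. of_nat (c i) *s g i)"
    by (rule sum.image_gen[OF assms])
  also have "\<dots> = (\<Sum>y\<in>g ` I. of_nat (\<Sum>i\<in>{i \<in> I. g i = y}. c i) *s y)"
    by (intro sum.cong refl) (simp add: vec.scale_sum_left)
  finally show "x \<in> ncone \<beta> (g ` I)"
    unfolding ncone_def x by (intro CollectI exI[of _ "\<lambda>y. \<Sum>i\<in>{i \<in> I. g i = y}. c i"]) simp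
next
  fix x assume "x \<in> ncone \<beta> (g ` I)"
  then obtain c where x: "x = \<beta> + (\<Sum>y\<in>g ` I. of_nat (c y) *s y)"
    by (auto simp: ncone_def)
  obtain J where J: "J \<subseteq> I" "inj_on g J" "g ` I = g ` J"
    using subset_image_inj[of "g ` I" g I] by auto
  have "(\<Sum>y\<in>g ` I. of_nat (c y) *s y) = (\<Sum>i\<in>J. of_nat (c (g i)) *s g i)"
    using J by (simp add: sum.reindex)
  also have "\<dots> = (\<Sum>i\<in>I. of_nat (if i \<in> J then c (g i) else 0) *s g i)"
    using J(1) assms by (intro sum.mono_neutral_cong_left) auto
  finally show "x \<in> {\<beta> + (\<Sum>i\<in>I. of_nat (c i) *s g i) | c :: 'i \<Rightarrow> nat. True}"
    unfolding x by (intro CollectI exI[of _ "\<lambda>i. if i \<in> J then c (g i) else 0"]) simp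
qed

section \<open>Factorizations joined by chains\<close>

definition tuples :: "nat \<Rightarrow> (nat \<Rightarrow> nat) set" where
  "tuples r = {a. \<forall>i\<ge>r. a i = 0}"

definition fact_sum :: "nat \<Rightarrow> (nat \<Rightarrow> 'a::comm_monoid_add) \<Rightarrow> (nat \<Rightarrow> nat) \<Rightarrow> 'a" where
  "fact_sum r \<alpha> a = (\<Sum>i<r. nsmul (a i) (\<alpha> i))"

definition step :: "nat \<Rightarrow> (nat \<Rightarrow> 'a::comm_monoid_add) \<Rightarrow> nat \<Rightarrow> (nat \<Rightarrow> nat) \<Rightarrow> (nat \<Rightarrow> nat) \<Rightarrow> bool" where
  "step r \<alpha> N a b \<longleftrightarrow> a \<in> tuples r \<and> b \<in> tuples r \<and> fact_sum r \<alpha> a = fact_sum r \<alpha> b \<and>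
     fact_dist r a b \<le> N"

abbreviation linked :: "nat \<Rightarrow> (nat \<Rightarrow> 'a::comm_monoid_add) \<Rightarrow> nat \<Rightarrow> (nat \<Rightarrow> nat) \<Rightarrow> (nat \<Rightarrow> nat) \<Rightarrow> bool" where
  "linked r \<alpha> N \<equiv> (step r \<alpha> N)\<^sup>*\<^sup>*"

definition disconnected :: "nat \<Rightarrow> (nat \<Rightarrow> 'a::comm_monoid_add) \<Rightarrow> nat \<Rightarrow> 'a set" where
  "disconnected r \<alpha> N =
     {x. \<exists>a\<in>factorizations r \<alpha> x. \<exists>b\<in>factorizations r \<alpha> x. \<not> linked r \<alpha> N a b}"

definition lex_less :: "nat \<Rightarrow> (nat \<Rightarrow> nat) \<Rightarrow> (nat \<Rightarrow> nat) \<Rightarrow> bool" where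
  "lex_less r a b \<longleftrightarrow> (\<exists>i<r. a i < b i \<and> (\<forall>k<i. a k = b k))"

text \<open>
The elements of \<open>\<nat>\<^sup>r\<close> that are not least in their class. If \<open>R\<close> is a congruence and binomials are
formed from its pairs, these are the exponents of the initial monomials of the binomial ideal.
\<close>
definition reducible :: "nat \<Rightarrow> ((nat \<Rightarrow> nat) \<Rightarrow> (nat \<Rightarrow> nat) \<Rightarrow> bool) \<Rightarrow> (nat \<Rightarrow> nat) set" where
  "reducible r R = {b \<in> tuples r. \<exists>a\<in>tuples r. R a b \<and> lex_less r a b}"

definition same_sum :: "nat \<Rightarrow> (nat \<Rightarrow> 'a::comm_monoid_add) \<Rightarrow> (nat \<Rightarrow> nat) \<Rightarrow> (nat \<Rightarrow> nat) \<Rightarrow> bool" where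
  "same_sum r \<alpha> a b \<longleftrightarrow> fact_sum r \<alpha> a = fact_sum r \<alpha> b"

definition upclosed :: "nat \<Rightarrow> (nat \<Rightarrow> nat) set \<Rightarrow> bool" where
  "upclosed r V \<longleftrightarrow> V \<subseteq> tuples r \<and> (\<forall>a\<in>V. \<forall>b\<in>tuples r. (\<forall>i. a i \<le> b i) \<longrightarrow> b \<in> V)"

lemma nsmul_add: "nsmul (m + n) x = nsmul m x + nsmul n x"
  by (induction m) (simp_all add: ac_simps)

lemma nsmul_mult: "nsmul (m * n) x = nsmul m (nsmul n x)"
  by (induction m) (simp_all add: nsmul_add)

lemma mem_factorizations: "a \<in> factorizations r \<alpha> x \<longleftrightarrow> a \<in> tuples r \<and> fact_sum r \<alpha> a = x"
  by (auto simp: factorizations_def tuples_def fact_sum_def)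

lemma fact_sum_add: "fact_sum r \<alpha> (\<lambda>i. a i + c i) = fact_sum r \<alpha> a + fact_sum r \<alpha> c"
  by (simp add: fact_sum_def nsmul_add sum.distrib)

lemma tuples_add: "a \<in> tuples r \<Longrightarrow> c \<in> tuples r \<Longrightarrow> (\<lambda>i. a i + c i) \<in> tuples r"
  by (simp add: tuples_def)

lemma chain_imp_linked:
  "is_chain r \<alpha> x N a b as \<Longrightarrow> linked r \<alpha> N a b"
proof (induction as arbitrary: a)
  case (Cons c as)
  show ?case
  proof (cases as)
    case Nil
    with Cons.prems show ?thesis by (auto simp: is_chain_def)
  next
    case (Cons d ds)
    have "is_chain r \<alpha> x N d b as"
      using Cons.prems Cons by (auto simp: is_chain_def)
    moreover have "step r \<alpha> N a d"
      using Cons.prems Cons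
      by (auto simp: is_chain_def step_def mem_factorizations dest: spec[of _ 0])
    ultimately show ?thesis
      using Cons.IH by (metis converse_rtranclp_into_rtranclp)
  qed
qed (simp add: is_chain_def)

lemma linked_imp_chain:
  assumes "linked r \<alpha> N a b" "a \<in> factorizations r \<alpha> x"
  shows "\<exists>as. is_chain r \<alpha> x N a b as"
  using assms
proof (induction rule: converse_rtranclp_induct)
  case base
  then show ?case
    by (intro exI[of _ "[b]"]) (simp add: is_chain_def)
next
  case (step a c)
  then have "c \<in> factorizations r \<alpha> x"
    by (simp add: mem_factorizations step_def)
  then obtain as where as: "is_chain r \<alpha> x N c b as"
    using step.IH by blast
  then have "as \<noteq> []" "as ! 0 = c"
    by (auto simp: is_chain_def hd_conv_nth)
  then have "is_chain r \<alpha> x N a b (a # as)"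
    using as step by (auto simp: is_chain_def step_def nth_Cons split: nat.splits)
  then show ?case by blast
qed

lemma chain_iff_linked:
  "a \<in> factorizations r \<alpha> x \<Longrightarrow> (\<exists>as. is_chain r \<alpha> x N a b as) \<longleftrightarrow> linked r \<alpha> N a b"
  using chain_imp_linked linked_imp_chain by metis

lemma linked_mono: "linked r \<alpha> M a b \<Longrightarrow> M \<le> N \<Longrightarrow> linked r \<alpha> N a b"
  by (erule rtranclp_mono[THEN predicate2D, rotated]) (auto simp: step_def)

lemma linked_sym: "linked r \<alpha> N a b \<Longrightarrow> linked r \<alpha> N b a"
proof (induction rule: rtranclp_induct)
  case (step b c)
  then have "step r \<alpha> N c b"
    by (simp add: step_def fact_dist_def fact_gcd_def max.commute min.commute)
  with step.IH show ?case
    by (metis converse_rtranclp_into_rtranclp)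
qed simp

lemma linked_tuples: "linked r \<alpha> N a b \<Longrightarrow> a \<in> tuples r \<Longrightarrow> b \<in> tuples r"
  by (induction rule: rtranclp_induct) (auto simp: step_def)

lemma linked_same_sum: "linked r \<alpha> N a b \<Longrightarrow> same_sum r \<alpha> a b"
  by (induction rule: rtranclp_induct) (auto simp: step_def same_sum_def)

text \<open>
Adding the same tuple to both sides leaves differences to the gcd, hence distances, unchanged.
So chains can be translated.
\<close>
lemma linked_shift:
  "linked r \<alpha> N a b \<Longrightarrow> c \<in> tuples r \<Longrightarrow> linked r \<alpha> N (\<lambda>i. a i + c i) (\<lambda>i. b i + c i)"
proof (induction rule: rtranclp_induct)
  case (step b d)
  have "step r \<alpha> N (\<lambda>i. b i + c i) (\<lambda>i. d i + c i)"
    using step.hyps(2) step.prems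
    by (auto simp: step_def fact_sum_add tuples_add fact_dist_def fact_gcd_def
        min_add_distrib_left[symmetric])
  with step show ?case
    by (metis rtranclp.rtrancl_into_rtrancl)
qed simp

lemma lex_less_shift: "lex_less r a b \<Longrightarrow> lex_less r (\<lambda>i. a i + c i) (\<lambda>i. b i + c i)"
  by (simp add: lex_less_def)

lemma lex_less_total:
  assumes "a \<in> tuples r" "b \<in> tuples r" "a \<noteq> b"
  shows "lex_less r a b \<or> lex_less r b a"
proof -
  define i where "i = (LEAST i. a i \<noteq> b i)"
  have "\<exists>i. a i \<noteq> b i"
    using assms(3) by auto
  then have i: "a i \<noteq> b i"
    unfolding i_def by (rule LeastI_ex)
  have "a k = b k" if "k < i" for k
    using that not_less_Least unfolding i_def by blast
  moreover have "i < r"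
    using i assms by (force simp: tuples_def not_less[symmetric])
  ultimately show ?thesis
    using i unfolding lex_less_def by (metis linorder_neqE_nat)
qed

text \<open>
The lexicographic order on \<open>\<nat>\<^sup>r\<close> is well-founded although a tuple can have infinitely many
predecessors: the coordinates are minimized one after the other.
\<close>
lemma lex_least:
  assumes "S \<subseteq> tuples r" "S \<noteq> {}"
  obtains a where "a \<in> S" "\<And>b. b \<in> S \<Longrightarrow> \<not> lex_less r b a"
proof -
  have "\<exists>a\<in>S. \<forall>b\<in>S. \<not> lex_less n b a" for n
  proof (induction n)
    case 0
    then show ?case using assms by (auto simp: lex_less_def)
  next
    case (Suc n)
    then obtain a where a: "a \<in> S" "\<forall>b\<in>S. \<not> lex_less n b a" by blast
    obtain c where c: "c \<in> S" "\<forall>k<n. c k = a k"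
      and least: "\<And>b. b \<in> S \<Longrightarrow> \<forall>k<n. b k = a k \<Longrightarrow> c n \<le> b n"
      using ex_has_least_nat[of "\<lambda>b. b \<in> S \<and> (\<forall>k<n. b k = a k)" a "\<lambda>b. b n"] a(1) by blast
    \<comment> \<open>Before coordinate \<open>n\<close> the tuple \<open>c\<close> agrees with \<open>a\<close>; at \<open>n\<close> it is minimal by choice.\<close>
    have "\<not> lex_less (Suc n) b c" if "b \<in> S" for b
    proof
      assume "lex_less (Suc n) b c"
      then obtain i where i: "i < Suc n" "b i < c i" "\<forall>k<i. b k = c k"
        by (auto simp: lex_less_def)
      show False
      proof (cases "i = n")
        case True
        then show False using least[OF that] i c by auto
      next
        case False
        then have "lex_less n b a"
          using i c unfolding lex_less_def by (intro exI[of _ i]) auto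
        then show False using a that by blast
      qed
    qed
    with c(1) show ?case by blast
  qed
  then show ?thesis using that by blast
qed

lemma reducible_upclosed:
  assumes "\<And>a b c. R a b \<Longrightarrow> c \<in> tuples r \<Longrightarrow> R (\<lambda>i. a i + c i) (\<lambda>i. b i + c i)"
  shows "upclosed r (reducible r R)"
  unfolding upclosed_def
proof (intro conjI ballI impI)
  fix b b' assume "b \<in> reducible r R" and b': "b' \<in> tuples r" "\<forall>i. b i \<le> b' i"
  then obtain a where a: "a \<in> tuples r" "R a b" "lex_less r a b" "b \<in> tuples r"
    by (auto simp: reducible_def)
  define c where "c i = b' i - b i" for i
  have c: "c \<in> tuples r" "(\<lambda>i. b i + c i) = b'"
    using b' by (auto simp: c_def tuples_def)
  then show "b' \<in> reducible r R"
    using assms[OF a(2) c(1)] lex_less_shift[OF a(3), of c] a(1) b'(1) tuples_add[OF a(1) c(1)]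
    unfolding reducible_def c(2) by blast
qed (auto simp: reducible_def)

lemma linked_upclosed: "upclosed r (reducible r (linked r \<alpha> N))"
  by (intro reducible_upclosed linked_shift)

lemma same_sum_upclosed: "upclosed r (reducible r (same_sum r \<alpha>))"
  by (intro reducible_upclosed) (simp add: same_sum_def fact_sum_add)

text \<open>
If two factorizations of \<open>x\<close> are not joined by an \<open>N\<close>-chain, take the least elements of their two
classes. They are different, so the larger one is least in its class but not among all
factorizations of \<open>x\<close>. Conversely, a tuple of this kind is not joined to a lexicographically
smaller factorization of \<open>x\<close>.
\<close>
lemma disconnected_eq:
  "disconnected r \<alpha> N =
    fact_sum r \<alpha> ` (reducible r (same_sum r \<alpha>) - reducible r (linked r \<alpha> N))"
proof (intro set_eqI iffI)
  fix x assume "x \<in> disconnected r \<alpha> N"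
  then obtain a b where ab: "a \<in> tuples r" "fact_sum r \<alpha> a = x" "b \<in> tuples r"
    "fact_sum r \<alpha> b = x" "\<not> linked r \<alpha> N a b"
    by (auto simp: disconnected_def mem_factorizations)
  have normal: "\<exists>a'. linked r \<alpha> N a a' \<and> a' \<in> tuples r \<and> a' \<notin> reducible r (linked r \<alpha> N)"
    if "a \<in> tuples r" for a
  proof -
    have "Collect (linked r \<alpha> N a) \<subseteq> tuples r" "Collect (linked r \<alpha> N a) \<noteq> {}"
      using linked_tuples that by blast+
    then obtain a' where a': "linked r \<alpha> N a a'" "\<And>c. linked r \<alpha> N a c \<Longrightarrow> \<not> lex_less r c a'"
      using lex_least by (metis mem_Collect_eq)
    have "a' \<notin> reducible r (linked r \<alpha> N)"
    proof
      assume "a' \<in> reducible r (linked r \<alpha> N)"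
      then obtain c where "linked r \<alpha> N c a'" "lex_less r c a'"
        by (auto simp: reducible_def)
      then show False
        using a' linked_sym by (metis rtranclp_trans)
    qed
    then show ?thesis
      using a'(1) linked_tuples[OF a'(1) that] by blast
  qed
  obtain a' b' where a': "linked r \<alpha> N a a'" "a' \<in> tuples r" "a' \<notin> reducible r (linked r \<alpha> N)"
    and b': "linked r \<alpha> N b b'" "b' \<in> tuples r" "b' \<notin> reducible r (linked r \<alpha> N)"
    using normal ab(1,3) by blast
  have sums: "fact_sum r \<alpha> a' = x" "fact_sum r \<alpha> b' = x"
    using linked_same_sum[OF a'(1)] linked_same_sum[OF b'(1)] ab by (auto simp: same_sum_def)
  have "a' \<noteq> b'"
    using ab(5) a'(1) linked_sym[OF b'(1)] by (metis rtranclp_trans)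
  then have "lex_less r a' b' \<or> lex_less r b' a'"
    using lex_less_total a'(2) b'(2) by blast
  then have "b' \<in> reducible r (same_sum r \<alpha>) \<or> a' \<in> reducible r (same_sum r \<alpha>)"
    using a'(2) b'(2) sums by (auto simp: reducible_def same_sum_def)
  then show "x \<in> fact_sum r \<alpha> ` (reducible r (same_sum r \<alpha>) - reducible r (linked r \<alpha> N))"
  proof
    assume "b' \<in> reducible r (same_sum r \<alpha>)"
    then show ?thesis
      using b'(3) sums(2) by (intro image_eqI[where x = b']) simp_all
  next
    assume "a' \<in> reducible r (same_sum r \<alpha>)"
    then show ?thesis
      using a'(3) sums(1) by (intro image_eqI[where x = a']) simp_all
  qed
next
  fix x assume "x \<in> fact_sum r \<alpha> ` (reducible r (same_sum r \<alpha>) - reducible r (linked r \<alpha> N))"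
  then obtain a b where "a \<in> tuples r" "b \<in> tuples r" "fact_sum r \<alpha> a = x" "fact_sum r \<alpha> b = x"
    "\<not> linked r \<alpha> N a b"
    unfolding reducible_def same_sum_def by blast
  then show "x \<in> disconnected r \<alpha> N"
    unfolding disconnected_def mem_Collect_eq Bex_def mem_factorizations by blast
qed

section \<open>Truncation of up-closed sets\<close>

lemma mono_subseq_coord:
  fixes f :: "nat \<Rightarrow> nat"
  obtains g :: "nat \<Rightarrow> nat" where "strict_mono g" "incseq (\<lambda>k. f (g k))"
proof -
  obtain g where g: "strict_mono g" "monoseq (\<lambda>k. f (g k))"
    using seq_monosub by blast
  show ?thesis
  proof (cases "incseq (\<lambda>k. f (g k))")
    case True
    then show ?thesis using g that by blast
  next
    case False
    then have dec: "decseq (\<lambda>k. f (g k))"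
      using g(2) by (simp add: monoseq_iff)
    obtain n where n: "\<And>k. f (g n) \<le> f (g k)"
      using ex_has_least_nat[of "\<lambda>_. True" _ "\<lambda>k. f (g k)"] by blast
    have "f (g (n + k)) = f (g n)" for k
      using decseqD[OF dec, of n "n + k"] n[of "n + k"] by simp
    then have "incseq (\<lambda>k. f (g (n + k)))"
      by (simp add: mono_def)
    moreover have "strict_mono (\<lambda>k. g (n + k))"
      using g(1) by (simp add: strict_mono_def)
    ultimately show ?thesis using that[of "\<lambda>k. g (n + k)"] by blast
  qed
qed

lemma mono_subseq_tuples:
  fixes f :: "nat \<Rightarrow> nat \<Rightarrow> nat"
  shows "\<exists>g :: nat \<Rightarrow> nat. strict_mono g \<and> (\<forall>i<r. incseq (\<lambda>k. f (g k) i))"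
proof (induction r)
  case 0
  show ?case by (intro exI[of _ id]) (simp add: strict_mono_def)
next
  case (Suc r)
  then obtain g :: "nat \<Rightarrow> nat" where g: "strict_mono g" "\<forall>i<r. incseq (\<lambda>k. f (g k) i)" by blast
  obtain h :: "nat \<Rightarrow> nat" where h: "strict_mono h" "incseq (\<lambda>k. f (g (h k)) r)"
    using mono_subseq_coord[of "\<lambda>k. f (g k) r"] by blast
  have "incseq (\<lambda>k. f (g (h k)) i)" if "i < r" for i
    using g(2) that strict_mono_mono[OF h(1)] by (simp add: mono_def)
  then have "\<forall>i<Suc r. incseq (\<lambda>k. f (g (h k)) i)"
    using h(2) by (simp add: less_Suc_eq)
  moreover have "strict_mono (\<lambda>k. g (h k))"
    using g(1) h(1) by (simp add: strict_mono_def)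
  ultimately show ?case by blast
qed

text \<open>
Dickson's lemma in the form that truncation at a suitable height does not leave an up-closed set.
If no height works, there are \<open>f M \<in> V\<close> whose truncations at \<open>M\<close> lie outside of \<open>V\<close>. Pass to a
subsequence that is nondecreasing in every coordinate. A late member truncated at its own height
still dominates the first one, so the truncation belongs to \<open>V\<close>.
\<close>
lemma dickson:
  assumes "upclosed r V"
  shows "\<exists>M. \<forall>a\<in>V. (\<lambda>i. min (a i) M) \<in> V"
proof (rule ccontr)
  assume "\<not> ?thesis"
  then obtain f where f: "\<And>M. f M \<in> V" "\<And>M. (\<lambda>i. min (f M i) M) \<notin> V"
    by metis
  have tup: "f M i = 0" if "r \<le> i" for M i
    using f(1) assms that by (auto simp: upclosed_def tuples_def)
  obtain g :: "nat \<Rightarrow> nat" where g: "strict_mono g" "\<And>i. i < r \<Longrightarrow> incseq (\<lambda>k. f (g k) i)"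
    using mono_subseq_tuples[of r f] by blast
  \<comment> \<open>A height that no coordinate of \<open>f (g 0)\<close> exceeds.\<close>
  define k where "k = (\<Sum>i<r. f (g 0) i)"
  have "f (g 0) i \<le> min (f (g k) i) (g k)" for i
  proof (cases "i < r")
    case True
    have "f (g 0) i \<le> k"
      unfolding k_def using True by (intro member_le_sum) auto
    also have "k \<le> g k"
      using g(1) by (rule strict_mono_imp_increasing)
    finally show ?thesis
      using monoD[OF g(2)[OF True], of 0 k] by simp
  qed (use tup in simp)
  then have "(\<lambda>i. min (f (g k) i) (g k)) \<in> V"
    using assms f(1)[of "g 0"] tup unfolding upclosed_def tuples_def by auto
  with f(2) show False by blast
qed

lemma truncation:
  assumes "upclosed r V"
  shows "\<exists>M. \<forall>N\<ge>M. \<forall>a\<in>tuples r. a \<in> V \<longleftrightarrow> (\<lambda>i. min (a i) N) \<in> V"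
proof -
  obtain M where M: "\<forall>a\<in>V. (\<lambda>i. min (a i) M) \<in> V"
    using dickson[OF assms] by blast
  have up: "b \<in> V" if "a \<in> V" "b \<in> tuples r" "\<And>i. a i \<le> b i" for a b
    using assms that by (auto simp: upclosed_def)
  show ?thesis
  proof (intro exI[of _ M] allI impI ballI)
    fix a N assume a: "M \<le> N" "a \<in> tuples r"
    then have t: "(\<lambda>i. min (a i) N) \<in> tuples r"
      by (simp add: tuples_def)
    show "a \<in> V \<longleftrightarrow> (\<lambda>i. min (a i) N) \<in> V"
    proof
      assume "a \<in> V"
      then show "(\<lambda>i. min (a i) N) \<in> V"
        using M t a(1) up[of "\<lambda>i. min (a i) M" "\<lambda>i. min (a i) N"] by auto
    next
      assume "(\<lambda>i. min (a i) N) \<in> V"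
      then show "a \<in> V"
        using up[of "\<lambda>i. min (a i) N" a] a by auto
    qed
  qed
qed

lemma finite_box: "finite {a \<in> tuples r. \<forall>i<r. a i < K}"
proof -
  have "{a \<in> tuples r. \<forall>i<r. a i < K} =
      {a. \<forall>i. (i \<in> {..<r} \<longrightarrow> a i \<in> {..<K}) \<and> (i \<notin> {..<r} \<longrightarrow> a i = 0)}"
    unfolding tuples_def mem_Collect_eq lessThan_iff not_less by blast
  then show ?thesis
    using finite_set_of_finite_funs[of "{..<r}" "{..<K}" 0] by simp
qed

text \<open>
Up-closed sets satisfy the ascending chain condition: each of the finitely many truncated
reducible tuples is already \<open>n\<close>-chain reducible for some \<open>n\<close>, and a common bound of these \<open>n\<close> serves
for all tuples.
\<close>
lemma disconnected_eventually_empty: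
  "\<exists>J. \<forall>N\<ge>J. disconnected r \<alpha> N = {}"
proof -
  let ?V = "reducible r (same_sum r \<alpha>)"
  obtain M where M: "\<forall>a\<in>?V. (\<lambda>i. min (a i) M) \<in> ?V"
    using dickson[OF same_sum_upclosed] ..
  define Q where "Q = {a \<in> tuples r. \<forall>i<r. a i < Suc M} \<inter> ?V"
  have "finite Q"
    using finite_box[of r "Suc M"] by (simp add: Q_def)
  have "\<exists>N. b \<in> reducible r (linked r \<alpha> N)" if b: "b \<in> Q" for b
  proof -
    obtain a where a: "a \<in> tuples r" "b \<in> tuples r" "same_sum r \<alpha> a b" "lex_less r a b"
      using b by (auto simp: Q_def reducible_def)
    then have "step r \<alpha> (fact_dist r a b) a b"
      by (simp add: step_def same_sum_def)
    then show ?thesis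
      using a unfolding reducible_def by blast
  qed
  then obtain n where n: "\<And>b. b \<in> Q \<Longrightarrow> b \<in> reducible r (linked r \<alpha> (n b))"
    by metis
  have "disconnected r \<alpha> N = {}" if N: "(\<Sum>b\<in>Q. n b) \<le> N" for N
  proof -
    have "a \<in> reducible r (linked r \<alpha> N)" if a: "a \<in> ?V" for a
    proof -
      let ?b = "\<lambda>i. min (a i) M"
      have t: "a \<in> tuples r"
        using a by (simp add: reducible_def)
      have "?b \<in> Q"
        using M a by (auto simp: Q_def reducible_def)
      then have "n ?b \<le> N"
        using N \<open>finite Q\<close> member_le_sum[of ?b Q n] by simp
      then have "?b \<in> reducible r (linked r \<alpha> N)"
        using n[OF \<open>?b \<in> Q\<close>] linked_mono unfolding reducible_def by blast
      then show ?thesis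
        using linked_upclosed[of r \<alpha> N] t unfolding upclosed_def by (meson min.cobounded1)
    qed
    then show ?thesis
      unfolding disconnected_eq by blast
  qed
  then show ?thesis by blast
qed

text \<open>
By \<open>disconnected_eventually_empty\<close> the minimum in the definition of the catenary degree is attained.
\<close>
lemma catenary_degree_le_iff:
  "catenary_degree r \<alpha> x \<le> N \<longleftrightarrow> x \<notin> disconnected r \<alpha> N"
proof -
  have eq: "catenary_degree r \<alpha> x = (LEAST N. x \<notin> disconnected r \<alpha> N)"
    unfolding catenary_degree_def disconnected_def
    by (intro arg_cong[where f = Least] ext) (simp add: chain_iff_linked cong: ball_cong)
  obtain J where "x \<notin> disconnected r \<alpha> J"
    using disconnected_eventually_empty[of r \<alpha>] by blast
  then have least: "x \<notin> disconnected r \<alpha> (catenary_degree r \<alpha> x)"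
    unfolding eq by (rule LeastI)
  show ?thesis
  proof
    assume "catenary_degree r \<alpha> x \<le> N"
    with least show "x \<notin> disconnected r \<alpha> N"
      unfolding disconnected_def using linked_mono by blast
  next
    assume "x \<notin> disconnected r \<alpha> N"
    then show "catenary_degree r \<alpha> x \<le> N"
      unfolding eq by (rule Least_le)
  qed
qed

lemma catenary_degree_eq_iff:
  assumes "0 < j"
  shows "catenary_degree r \<alpha> x = j \<longleftrightarrow> x \<in> disconnected r \<alpha> (j - 1) - disconnected r \<alpha> j"
proof -
  have "catenary_degree r \<alpha> x = j \<longleftrightarrow>
      catenary_degree r \<alpha> x \<le> j \<and> \<not> catenary_degree r \<alpha> x \<le> j - 1"
    using assms by linarith
  then show ?thesis
    unfolding catenary_degree_le_iff by blast
qed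

text \<open>
A difference \<open>E\<close> of up-closed sets does not see how far a coordinate exceeds a common truncation
height \<open>M\<close>. Reducing the excess of each coordinate modulo \<open>m\<close> maps \<open>E\<close> into a finite box, and the
fibre over \<open>v\<close> consists of the tuples obtained from \<open>v\<close> by adding multiples of \<open>m\<close> to the coordinates
that are at least \<open>M\<close>. The modulus will be the order of the torsion group.
\<close>
lemma disconnected_cells:
  assumes "0 < m"
  shows "\<exists>W F. finite W \<and> (\<forall>v\<in>W. F v \<subseteq> {..<r}) \<and> disconnected r \<alpha> N =
      (\<Union>v\<in>W. {fact_sum r \<alpha> v + (\<Sum>i\<in>F v. nsmul (c i) (nsmul m (\<alpha> i))) | c :: nat \<Rightarrow> nat. True})"
proof -
  let ?U = "reducible r (same_sum r \<alpha>)" and ?V = "reducible r (linked r \<alpha> N)"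
  obtain M1 where M1: "\<forall>N\<ge>M1. \<forall>a\<in>tuples r. a \<in> ?U \<longleftrightarrow> (\<lambda>i. min (a i) N) \<in> ?U"
    using truncation[OF same_sum_upclosed] ..
  obtain M2 where M2: "\<forall>N\<ge>M2. \<forall>a\<in>tuples r. a \<in> ?V \<longleftrightarrow> (\<lambda>i. min (a i) N) \<in> ?V"
    using truncation[OF linked_upclosed] ..
  define M where "M = max M1 M2"
  define E where "E = ?U - ?V"
  have E: "a \<in> E \<longleftrightarrow> b \<in> E"
    if "a \<in> tuples r" "b \<in> tuples r" "\<And>i. min (a i) M = min (b i) M" for a b
  proof -
    have "M1 \<le> M" "M2 \<le> M"
      by (simp_all add: M_def)
    then have "c \<in> E \<longleftrightarrow> (\<lambda>i. min (c i) M) \<in> E" if "c \<in> tuples r" for c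
      using M1 M2 that by (simp add: E_def)
    from this[OF that(1)] this[OF that(2)] show ?thesis
      by (simp only: that(3))
  qed
  define F where "F v = {i. i < r \<and> M \<le> v i}" for v :: "nat \<Rightarrow> nat"
  define add where "add v c = (\<lambda>i. v i + (if i \<in> F v then c i * m else 0))" for v c :: "nat \<Rightarrow> nat"
  define W where "W = {a \<in> tuples r. \<forall>i<r. a i < M + m} \<inter> E"
  have add: "add v c \<in> tuples r" "add v c \<in> E \<longleftrightarrow> v \<in> E"
    "fact_sum r \<alpha> (add v c) = fact_sum r \<alpha> v + (\<Sum>i\<in>F v. nsmul (c i) (nsmul m (\<alpha> i)))"
    if "v \<in> tuples r" for v c
  proof -
    show t: "add v c \<in> tuples r"
      using that by (simp add: tuples_def add_def F_def)
    show "add v c \<in> E \<longleftrightarrow> v \<in> E"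
      by (rule E[OF t that]) (simp add: add_def F_def)
    have "(\<Sum>i\<in>F v. nsmul (c i) (nsmul m (\<alpha> i))) =
        (\<Sum>i<r. nsmul (if i \<in> F v then c i * m else 0) (\<alpha> i))"
      by (intro sum.mono_neutral_cong_left) (auto simp: F_def nsmul_mult)
    then show "fact_sum r \<alpha> (add v c) =
        fact_sum r \<alpha> v + (\<Sum>i\<in>F v. nsmul (c i) (nsmul m (\<alpha> i)))"
      unfolding add_def fact_sum_add by (simp add: fact_sum_def)
  qed
  have E_sub: "E \<subseteq> tuples r"
    by (auto simp: E_def reducible_def)
  have "\<exists>v\<in>W. \<exists>c. a = add v c" if "a \<in> E" for a
  proof -
    define v where "v i = (if a i < M then a i else M + (a i - M) mod m)" for i
    define v' where "v' i = (if i < r then v i else 0)" for i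
    have a: "a = add v' (\<lambda>i. (a i - M) div m)"
    proof
      fix i show "a i = add v' (\<lambda>i. (a i - M) div m) i"
        using E_sub that by (auto simp: add_def v'_def v_def F_def tuples_def)
    qed
    have v': "v' \<in> tuples r"
      by (simp add: tuples_def v'_def)
    then have "v' \<in> E"
      using add(2) a that by metis
    moreover have "v' i < M + m" if "i < r" for i
      using assms that by (auto simp: v'_def v_def)
    ultimately show ?thesis
      using a v' unfolding W_def by blast
  qed
  moreover have "add v c \<in> E" if "v \<in> W" for v c
    using that add(2) by (auto simp: W_def)
  ultimately have "E = (\<Union>v\<in>W. {add v c | c. True})"
    by blast
  then have "fact_sum r \<alpha> ` E = (\<Union>v\<in>W. {fact_sum r \<alpha> (add v c) | c. True})"
    by blast
  also have "\<dots> = (\<Union>v\<in>W. {fact_sum r \<alpha> v + (\<Sum>i\<in>F v. nsmul (c i) (nsmul m (\<alpha> i))) | c. True})"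
    using add(3) by (intro SUP_cong refl) (simp add: W_def)
  finally have "disconnected r \<alpha> N =
      (\<Union>v\<in>W. {fact_sum r \<alpha> v + (\<Sum>i\<in>F v. nsmul (c i) (nsmul m (\<alpha> i))) | c. True})"
    by (simp add: disconnected_eq E_def)
  moreover have "finite W"
    using finite_box by (simp add: W_def)
  ultimately show ?thesis
    by (intro exI[of _ W] exI[of _ F]) (auto simp: F_def)
qed

lemma submonoid_hull_eq:
  "submonoid hull (\<alpha> ` {..<r}) = {x. factorizations r \<alpha> x \<noteq> {}}"
proof (rule hull_unique)
  show "\<alpha> ` {..<r} \<subseteq> {x. factorizations r \<alpha> x \<noteq> {}}"
  proof (intro image_subsetI CollectI)
    fix i assume i: "i \<in> {..<r}"
    have "fact_sum r \<alpha> (\<lambda>k. if k = i then 1 else 0) = (\<Sum>k<r. if k = i then \<alpha> i else 0)"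
      unfolding fact_sum_def by (intro sum.cong) auto
    then have "(\<lambda>k. if k = i then 1 else 0) \<in> factorizations r \<alpha> (\<alpha> i)"
      using i by (auto simp: mem_factorizations tuples_def)
    then show "factorizations r \<alpha> (\<alpha> i) \<noteq> {}" by blast
  qed
  show "submonoid {x. factorizations r \<alpha> x \<noteq> {}}"
    unfolding submonoid_def
  proof (intro conjI ballI)
    have "(\<lambda>k. 0) \<in> factorizations r \<alpha> 0"
      by (simp add: mem_factorizations tuples_def fact_sum_def)
    then show "0 \<in> {x. factorizations r \<alpha> x \<noteq> {}}" by blast
  next
    fix x y assume "x \<in> {x. factorizations r \<alpha> x \<noteq> {}}" "y \<in> {x. factorizations r \<alpha> x \<noteq> {}}"
    then obtain a b where "a \<in> factorizations r \<alpha> x" "b \<in> factorizations r \<alpha> y" by blast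
    then have "(\<lambda>i. a i + b i) \<in> factorizations r \<alpha> (x + y)"
      by (simp add: mem_factorizations tuples_add fact_sum_add)
    then show "x + y \<in> {x. factorizations r \<alpha> x \<noteq> {}}" by blast
  qed
next
  fix S assume S: "\<alpha> ` {..<r} \<subseteq> S" "submonoid S"
  have mult: "nsmul n x \<in> S" if "x \<in> S" for n x
    using that S(2) by (induction n) (auto simp: submonoid_def)
  have "(\<Sum>i\<in>I. nsmul (a i) (\<alpha> i)) \<in> S" if "finite I" "I \<subseteq> {..<r}" for I and a :: "nat \<Rightarrow> nat"
    using that
  proof (induction I)
    case (insert i I)
    then show ?case
      using S mult[of "\<alpha> i"] by (auto simp: submonoid_def)
  qed (use S in \<open>simp add: submonoid_def\<close>)
  then show "{x. factorizations r \<alpha> x \<noteq> {}} \<subseteq> S"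
    by (auto simp: mem_factorizations fact_sum_def)
qed

section \<open>From rational cones to cones in the monoid\<close>

definition rat_vec :: "nat^'d \<Rightarrow> rat^'d" where
  "rat_vec x = (\<chi> i. of_nat (x $ i))"

definition layer :: "'t \<Rightarrow> (rat^'d) set \<Rightarrow> ((nat^'d) \<times> 't) set" where
  "layer t K = {x. rat_vec (fst x) \<in> K \<and> snd x = t}"

lemma fst_nsmul: "fst (nsmul n x) = nsmul n (fst x)"
  by (induction n) simp_all

lemma snd_nsmul: "snd (nsmul n x) = nsmul n (snd x)"
  by (induction n) simp_all

lemma fst_sum: "fst (\<Sum>i\<in>I. f i) = (\<Sum>i\<in>I. fst (f i))"
  by (induction I rule: infinite_finite_induct) simp_all

lemma snd_sum: "snd (\<Sum>i\<in>I. f i) = (\<Sum>i\<in>I. snd (f i))"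
  by (induction I rule: infinite_finite_induct) simp_all

lemma nsmul_zero: "nsmul n 0 = 0"
  by (induction n) simp_all

lemma inj_rat_vec: "inj rat_vec"
  by (rule injI) (simp add: rat_vec_def vec_eq_iff)

lemma rat_vec_add: "rat_vec (x + y) = rat_vec x + rat_vec y"
  by (simp add: rat_vec_def vec_eq_iff)

lemma rat_vec_zero: "rat_vec 0 = 0"
  by (simp add: rat_vec_def vec_eq_iff)

lemma rat_vec_nsmul: "rat_vec (nsmul n x) = of_nat n *s rat_vec x"
  by (induction n) (simp_all add: rat_vec_zero rat_vec_add vec.scale_left_distrib)

lemma rat_vec_sum: "rat_vec (\<Sum>i\<in>I. f i) = (\<Sum>i\<in>I. rat_vec (f i))"
  by (induction I rule: infinite_finite_induct) (simp_all add: rat_vec_zero rat_vec_add)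

lemma rat_vec_nat_vecs: "rat_vec x \<in> nat_vecs"
  by (simp add: rat_vec_def nat_vecs_def)

lemma nat_vecs_rat_vec:
  assumes "v \<in> nat_vecs"
  obtains x where "v = rat_vec x"
proof -
  have "\<forall>i. \<exists>n. v $ i = of_nat n"
    using assms by (auto simp: nat_vecs_def elim: Nats_cases)
  then obtain n where "\<And>i. v $ i = of_nat (n i)"
    by metis
  then have "v = rat_vec (\<chi> i. n i)"
    by (simp add: rat_vec_def vec_eq_iff)
  then show ?thesis by (rule that)
qed

text \<open>
Translation by \<open>x\<close> permutes the group, so the sum \<open>s\<close> of all its elements satisfies
\<open>s = s + CARD('t) x\<close>.
\<close>
lemma nsmul_card:
  fixes x :: "'t::{ab_group_add, finite}"
  shows "nsmul CARD('t) x = 0"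
proof -
  have "(\<Sum>y\<in>S. x) = nsmul (card S) x" if "finite S" for S :: "'t set"
    using that by induction simp_all
  then have *: "(\<Sum>y\<in>(UNIV :: 't set). x) = nsmul CARD('t) x"
    by simp
  have "(\<Sum>y\<in>UNIV. y) = (\<Sum>y\<in>UNIV. y + x)"
    by (rule sum.reindex_bij_witness[of _ "\<lambda>y. y + x" "\<lambda>y. y - x"]) simp_all
  then show ?thesis
    by (simp add: sum.distrib *)
qed

lemma fst_zsmul_nth: "fst (zsmul k x) $ i = k * fst x $ i"
  for x :: "(int^'d) \<times> 't::ab_group_add"
proof -
  have "fst (nsmul n x) $ i = int n * fst x $ i" for n
    by (induction n) (simp_all add: algebra_simps)
  then show ?thesis
    by (simp add: zsmul_def)
qed

lemma rat_vec_zsmul_sum: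
  fixes x :: "nat \<Rightarrow> (nat^'d) \<times> 't::ab_group_add"
  assumes "(\<Sum>j\<in>I. zsmul (c j) (to_group (x j))) = 0"
  shows "(\<Sum>j\<in>I. of_int (c j) *s rat_vec (fst (x j))) = 0"
proof -
  have "(\<Sum>j\<in>I. of_int (c j) *s rat_vec (fst (x j))) $ i = 0" for i
  proof -
    have "(\<Sum>j\<in>I. of_int (c j) *s rat_vec (fst (x j))) $ i =
        of_int (fst (\<Sum>j\<in>I. zsmul (c j) (to_group (x j))) $ i)"
      by (simp add: fst_sum fst_zsmul_nth rat_vec_def to_group_def)
    then show ?thesis
      by (simp add: assms)
  qed
  then show ?thesis
    by (simp add: vec_eq_iff)
qed

text \<open>
The lifted generators have torsion component zero, so an integral relation among them is the same
as a relation among the vectors in \<open>B\<close>.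
\<close>
lemma is_cone_layer:
  fixes t :: "'t::ab_group_add" and K :: "(rat^'d) set"
  assumes "simplicial K"
  shows "is_cone (layer t K)"
proof -
  obtain \<beta> B where K: "\<beta> \<in> nat_vecs" "B \<subseteq> nat_vecs" "finite B" "vec.independent B" "K = ncone \<beta> B"
    using assms by (auto simp: simplicial_def)
  obtain \<beta>' where \<beta>': "\<beta> = rat_vec \<beta>'"
    using nat_vecs_rat_vec[OF K(1)] .
  obtain b where b: "bij_betw b {..<card B} B"
    using ex_bij_betw_nat_finite[OF K(3)] by (auto simp: atLeast0LessThan)
  have "\<forall>j<card B. \<exists>g. b j = rat_vec g"
    using b K(2) nat_vecs_rat_vec by (metis bij_betwE lessThan_iff subsetD)
  then obtain g where g: "\<And>j. j < card B \<Longrightarrow> b j = rat_vec (g j)"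
    by metis
  define \<gamma> :: "nat \<Rightarrow> (nat^'d) \<times> 't" where "\<gamma> j = (g j, 0)" for j
  have inj: "inj_on b {..<card B}" and img: "b ` {..<card B} = B"
    using b by (auto simp: bij_betw_def)
  have "lin_indep (card B) \<gamma>"
    unfolding lin_indep_def
  proof (intro allI impI)
    fix c :: "nat \<Rightarrow> int" and j
    assume "(\<Sum>j<card B. zsmul (c j) (to_group (\<gamma> j))) = 0" and j: "j < card B"
    then have "(\<Sum>j<card B. of_int (c j) *s rat_vec (fst (\<gamma> j))) = 0"
      by (intro rat_vec_zsmul_sum)
    then have "(\<Sum>j<card B. of_int (c j) *s b j) = 0"
      by (simp add: \<gamma>_def g)
    moreover have "(\<Sum>v\<in>B. of_int (c (inv_into {..<card B} b v)) *s v) =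
        (\<Sum>j<card B. of_int (c j) *s b j)"
      unfolding sum.reindex_bij_betw[OF b, symmetric] using inj by (intro sum.cong) simp_all
    ultimately have "of_int (c (inv_into {..<card B} b (b j))) = (0 :: rat)"
      using K(3,4) j img by (intro vec.independentD[of B B]) auto
    then show "c j = 0"
      using inj j by simp
  qed
  moreover have "layer t K = cone_of (\<beta>', t) (card B) \<gamma>"
  proof (intro set_eqI)
    fix x :: "(nat^'d) \<times> 't"
    have eq: "rat_vec (fst ((\<beta>', t) + (\<Sum>j<card B. nsmul (c j) (\<gamma> j)))) =
        \<beta> + (\<Sum>j<card B. of_nat (c j) *s b j)" for c
      by (simp add: \<beta>' fst_sum fst_nsmul \<gamma>_def rat_vec_add rat_vec_sum rat_vec_nsmul g)
    have snd_eq: "snd ((\<beta>', t) + (\<Sum>j<card B. nsmul (c j) (\<gamma> j))) = t" for c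
      by (simp add: snd_sum snd_nsmul \<gamma>_def nsmul_zero)
    have "x \<in> layer t K \<longleftrightarrow>
        (\<exists>c. rat_vec (fst x) = \<beta> + (\<Sum>j<card B. of_nat (c j) *s b j)) \<and> snd x = t"
      unfolding layer_def K(5) using ncone_family[of "{..<card B}" \<beta> b] img by auto
    also have "\<dots> \<longleftrightarrow> (\<exists>c. x = (\<beta>', t) + (\<Sum>j<card B. nsmul (c j) (\<gamma> j)))"
    proof (intro iffI; elim conjE exE)
      fix c assume "rat_vec (fst x) = \<beta> + (\<Sum>j<card B. of_nat (c j) *s b j)" "snd x = t"
      then have "x = (\<beta>', t) + (\<Sum>j<card B. nsmul (c j) (\<gamma> j))"
        using snd_eq[of c] eq[of c] by (intro prod_eqI injD[OF inj_rat_vec]) (simp_all only:)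
      then show "\<exists>c. x = (\<beta>', t) + (\<Sum>j<card B. nsmul (c j) (\<gamma> j))" by (rule exI[of _ c])
    next
      fix c assume x: "x = (\<beta>', t) + (\<Sum>j<card B. nsmul (c j) (\<gamma> j))"
      show "(\<exists>c. rat_vec (fst x) = \<beta> + (\<Sum>j<card B. of_nat (c j) *s b j)) \<and> snd x = t"
        unfolding x eq snd_eq by blast
    qed
    finally show "x \<in> layer t K \<longleftrightarrow> x \<in> cone_of (\<beta>', t) (card B) \<gamma>"
      unfolding cone_of_def by simp
  qed
  ultimately show ?thesis
    unfolding is_cone_def by blast
qed

lemma conical_nat_vecs: "conical (nat_vecs :: (rat^'d) set)"
proof -
  have basis: "rat_vec x = 0 + (\<Sum>i\<in>UNIV. of_nat (x $ i) *s axis i 1)" for x :: "nat^'d"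
    using basis_expansion[of "rat_vec x"] by (simp add: rat_vec_def)
  have "nat_vecs = {0 + (\<Sum>i\<in>UNIV. of_nat (c i) *s axis i 1 :: rat^'d) | c :: 'd \<Rightarrow> nat. True}"
  proof (intro set_eqI iffI)
    fix v :: "rat^'d" assume "v \<in> nat_vecs"
    then obtain x where "v = rat_vec x"
      using nat_vecs_rat_vec by blast
    then show "v \<in> {0 + (\<Sum>i\<in>UNIV. of_nat (c i) *s axis i 1) | c :: 'd \<Rightarrow> nat. True}"
      using basis[of x] by blast
  next
    fix v assume "v \<in> {0 + (\<Sum>i\<in>UNIV. of_nat (c i) *s axis i 1 :: rat^'d) | c :: 'd \<Rightarrow> nat. True}"
    then obtain c :: "'d \<Rightarrow> nat" where "v = 0 + (\<Sum>i\<in>UNIV. of_nat (c i) *s axis i 1)"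
      by blast
    then have "v = rat_vec (\<chi> i. c i)"
      by (simp add: basis)
    then show "v \<in> nat_vecs"
      by (simp add: rat_vec_nat_vecs)
  qed
  then have "nat_vecs = ncone 0 (range (\<lambda>i. axis i 1 :: rat^'d))"
    by (simp only: ncone_family[OF finite])
  moreover have "simplicial (ncone 0 (range (\<lambda>i. axis i 1 :: rat^'d)))"
    using independent_cart_basis
    by (intro simplicialI) (auto simp: nat_vecs_def axis_def cart_basis_def full_SetCompr_eq)
  ultimately show ?thesis
    by (simp add: conical_simplicial)
qed

lemma image_slice: "f ` {x. (x, t) \<in> {p c | c. True}} = {f (fst (p c)) | c. snd (p c) = t}"
proof (intro set_eqI iffI)
  fix y assume "y \<in> f ` {x. (x, t) \<in> {p c | c. True}}"
  then obtain x c where "y = f x" "(x, t) = p c"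
    by blast
  then have "y = f (fst (p c)) \<and> snd (p c) = t"
    by (metis fst_conv snd_conv)
  then show "y \<in> {f (fst (p c)) | c. snd (p c) = t}"
    by blast
next
  fix y assume "y \<in> {f (fst (p c)) | c. snd (p c) = t}"
  then obtain c where c: "y = f (fst (p c))" "(fst (p c), t) = p c"
    by force
  then show "y \<in> f ` {x. (x, t) \<in> {p c | c. True}}"
    by blast
qed

lemma tame_disconnected_slice:
  fixes \<alpha> :: "nat \<Rightarrow> (nat^'d) \<times> 't::{ab_group_add, finite}"
  shows "tame (rat_vec ` {x. (x, t) \<in> disconnected r \<alpha> N})"
proof -
  let ?m = "CARD('t)"
  obtain W F where W: "finite W" "\<forall>v\<in>W. F v \<subseteq> {..<r}"
    "disconnected r \<alpha> N =
      (\<Union>v\<in>W. {fact_sum r \<alpha> v + (\<Sum>i\<in>F v. nsmul (c i) (nsmul ?m (\<alpha> i))) | c. True})"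
    using disconnected_cells[of ?m r \<alpha> N, OF zero_less_card_finite] by blast
  let ?W = "{v \<in> W. snd (fact_sum r \<alpha> v) = t}"
  let ?K = "\<lambda>v. ncone (rat_vec (fst (fact_sum r \<alpha> v)))
    ((\<lambda>i. rat_vec (fst (nsmul ?m (\<alpha> i)))) ` F v)"
  have fin: "finite (F v)" if "v \<in> W" for v
    using W(2) that finite_subset by blast
  have cell: "rat_vec ` {x. (x, t) \<in> {fact_sum r \<alpha> v + (\<Sum>i\<in>F v. nsmul (c i) (nsmul ?m (\<alpha> i))) | c. True}} =
      (if snd (fact_sum r \<alpha> v) = t then ?K v else {})" if v: "v \<in> W" for v
  proof -
    let ?p = "\<lambda>c. fact_sum r \<alpha> v + (\<Sum>i\<in>F v. nsmul (c i) (nsmul ?m (\<alpha> i)))"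
    have snd_p: "snd (?p c) = snd (fact_sum r \<alpha> v)" for c
      by (simp add: snd_sum snd_nsmul nsmul_card nsmul_zero)
    have fst_p: "rat_vec (fst (?p c)) = rat_vec (fst (fact_sum r \<alpha> v)) +
        (\<Sum>i\<in>F v. of_nat (c i) *s rat_vec (fst (nsmul ?m (\<alpha> i))))" for c
      by (simp add: fst_sum fst_nsmul rat_vec_add rat_vec_sum rat_vec_nsmul)
    have "rat_vec ` {x. (x, t) \<in> {?p c | c. True}} = {rat_vec (fst (?p c)) | c. snd (?p c) = t}"
      by (rule image_slice)
    also have "\<dots> = (if snd (fact_sum r \<alpha> v) = t then ?K v else {})"
      unfolding snd_p fst_p ncone_family[OF fin[OF v], symmetric] by simp
    finally show ?thesis .
  qed
  have "rat_vec ` {x. (x, t) \<in> disconnected r \<alpha> N} =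
      (\<Union>v\<in>W. rat_vec ` {x. (x, t) \<in>
        {fact_sum r \<alpha> v + (\<Sum>i\<in>F v. nsmul (c i) (nsmul ?m (\<alpha> i))) | c. True}})"
    unfolding W(3) by blast
  also have "\<dots> = (\<Union>v\<in>W. if snd (fact_sum r \<alpha> v) = t then ?K v else {})"
    by (intro SUP_cong refl cell)
  finally show ?thesis
    using W(1) fin by (auto intro!: tame_UN tame_ncone)
qed

section \<open>The level sets of the catenary degree\<close>

text \<open>
In each of the finitely many layers of \<open>\<nat>\<^sup>d \<oplus> T\<close> the difference is a Boolean combination of tame sets
and hence cuts the cone \<open>\<nat>\<^sup>d\<close> into finitely many disjoint cones.
\<close>

lemma level_set_cones:
  fixes \<alpha> :: "nat \<Rightarrow> (nat^'d) \<times> 't::{ab_group_add, finite}"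
  shows "\<exists>\<C>. finite \<C> \<and> (\<forall>C\<in>\<C>. is_cone C) \<and> disjoint \<C> \<and>
    disconnected r \<alpha> M - disconnected r \<alpha> N = \<Union>\<C>"
proof -
  let ?S = "\<lambda>N t. rat_vec ` {x. (x, t) \<in> disconnected r \<alpha> N}"
  have "conical (nat_vecs \<inter> (?S M t - ?S N t))" for t
    using tame_splits_conical[OF tame_Diff conical_nat_vecs] tame_disconnected_slice
    by (metis splits_def)
  then have "\<forall>t. \<exists>\<C>. finite \<C> \<and> (\<forall>C\<in>\<C>. simplicial C) \<and> disjoint \<C> \<and>
      nat_vecs \<inter> (?S M t - ?S N t) = \<Union>\<C>"
    unfolding conical_def by blast
  then obtain \<C> where C: "\<And>t. finite (\<C> t)" "\<And>t C. C \<in> \<C> t \<Longrightarrow> simplicial C"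
    "\<And>t. disjoint (\<C> t)" "\<And>t. nat_vecs \<inter> (?S M t - ?S N t) = \<Union>(\<C> t)"
    by metis
  let ?D = "\<Union>t. layer t ` \<C> t"
  have mem: "x \<in> disconnected r \<alpha> M - disconnected r \<alpha> N \<longleftrightarrow> rat_vec (fst x) \<in> \<Union>(\<C> (snd x))" for x
  proof -
    have "rat_vec (fst x) \<in> ?S N (snd x) \<longleftrightarrow> x \<in> disconnected r \<alpha> N" for N
      by (simp add: inj_image_mem_iff[OF inj_rat_vec])
    then show ?thesis
      using rat_vec_nat_vecs[of "fst x"] C(4)[of "snd x"] by blast
  qed
  have "finite ?D"
    using C(1) by simp
  moreover have "\<forall>C\<in>?D. is_cone C"
    using C(2) is_cone_layer by blast
  moreover have "disjoint ?D"
  proof (rule disjointI)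
    fix A B assume AB: "A \<in> ?D" "B \<in> ?D" "A \<noteq> B"
    obtain t K where K: "K \<in> \<C> t" "A = layer t K"
      using AB(1) by blast
    obtain u L where L: "L \<in> \<C> u" "B = layer u L"
      using AB(2) by blast
    show "A \<inter> B = {}"
    proof (cases "t = u")
      case True
      then have "L \<in> \<C> t" "K \<noteq> L"
        using K L AB(3) by auto
      then have "K \<inter> L = {}"
        using C(3) K(1) by (intro disjointD)
      then show ?thesis
        unfolding K L layer_def by blast
    next
      case False
      then show ?thesis
        unfolding K L layer_def by blast
    qed
  qed
  moreover have "disconnected r \<alpha> M - disconnected r \<alpha> N = \<Union>?D"
  proof (intro set_eqI)
    fix x
    show "x \<in> disconnected r \<alpha> M - disconnected r \<alpha> N \<longleftrightarrow> x \<in> \<Union>?D"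
      unfolding mem layer_def by auto
  qed
  ultimately show ?thesis
    by blast
qed

lemma disjoint_sum_indicator:
  assumes "finite \<C>" "disjoint \<C>"
  shows "(\<Sum>C\<in>\<C>. if x \<in> C then q else 0) = (if x \<in> \<Union>\<C> then q else 0)"
proof (cases "x \<in> \<Union>\<C>")
  case True
  then obtain D where D: "D \<in> \<C>" "x \<in> D" by blast
  have "(\<Sum>C\<in>\<C>. if x \<in> C then q else 0) = (\<Sum>C\<in>\<C>. if C = D then q else 0)"
    using D assms(2) by (intro sum.cong) (auto simp: disjoint_def)
  then show ?thesis
    using True D(1) assms(1) by simp
qed (auto intro: sum.neutral)

lemma eventually_quasiconstantI:
  assumes "finite I" "\<And>i. i \<in> I \<Longrightarrow> is_cone (C i)"
    and "\<And>x. f x = (\<Sum>i\<in>I. if x \<in> C i then q i else 0)"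
  shows "eventually_quasiconstant f"
proof -
  obtain h where h: "bij_betw h {..<card I} I"
    using ex_bij_betw_nat_finite[OF assms(1)] by (auto simp: atLeast0LessThan)
  have "f = (\<lambda>x. \<Sum>k<card I. if x \<in> C (h k) then q (h k) else 0)"
    unfolding assms(3) using sum.reindex_bij_betw[OF h] by (intro ext) (rule sym)
  moreover have "\<forall>k<card I. is_cone (C (h k))"
    using assms(2) bij_betwE[OF h] by blast
  ultimately show ?thesis
    unfolding eventually_quasiconstant_def
    by (intro exI[of _ "card I"] exI[of _ "\<lambda>k. C (h k)"] exI[of _ "\<lambda>k. q (h k)"]) simp
qed

theorem corollary6p5:
  fixes \<Gamma> :: "((nat^'d) \<times> 't::{ab_group_add, finite}) set"
    and r :: nat
    and \<alpha> :: "nat \<Rightarrow> (nat^'d) \<times> 't"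
  assumes "reduced_monoid \<Gamma>"
    and "minimal_generators \<Gamma> r \<alpha>"
  shows "(\<forall>j\<ge>2. \<exists>\<C>. finite \<C> \<and> (\<forall>C\<in>\<C>. is_cone C) \<and> disjoint \<C> \<and>
            {x \<in> \<Gamma>. catenary_degree r \<alpha> x = j} = \<Union>\<C>) \<and>
         eventually_quasiconstant
           (extend_by_zero \<Gamma> (\<lambda>x. of_nat (catenary_degree r \<alpha> x)))"
proof -
  let ?c = "catenary_degree r \<alpha>"
  have \<Gamma>: "\<Gamma> = {x. factorizations r \<alpha> x \<noteq> {}}"
    using assms(2) submonoid_hull_eq[of \<alpha> r] by (simp add: minimal_generators_def)
  have level: "{x \<in> \<Gamma>. ?c x = j} = disconnected r \<alpha> (j - 1) - disconnected r \<alpha> j" if "0 < j" for j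
  proof -
    have "disconnected r \<alpha> (j - 1) \<subseteq> \<Gamma>"
      unfolding \<Gamma> disconnected_def by blast
    then show ?thesis
      using catenary_degree_eq_iff[OF that, of r \<alpha>] by blast
  qed
  have cones: "\<exists>\<C>. finite \<C> \<and> (\<forall>C\<in>\<C>. is_cone C) \<and> disjoint \<C> \<and> {x \<in> \<Gamma>. ?c x = j} = \<Union>\<C>"
    if "0 < j" for j
    unfolding level[OF that] by (rule level_set_cones)
  then have "\<forall>j\<in>{0<..}. \<exists>\<C>. finite \<C> \<and> (\<forall>C\<in>\<C>. is_cone C) \<and> disjoint \<C> \<and>
      {x \<in> \<Gamma>. ?c x = j} = \<Union>\<C>"
    by simp
  then obtain \<C> where C: "\<forall>j\<in>{0<..}. finite (\<C> j) \<and> (\<forall>C\<in>\<C> j. is_cone C) \<and> disjoint (\<C> j) \<and>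
      {x \<in> \<Gamma>. ?c x = j} = \<Union>(\<C> j)"
    by (rule bchoice[THEN exE])
  obtain J where "\<forall>N\<ge>J. disconnected r \<alpha> N = {}"
    using disconnected_eventually_empty by blast
  then have bound: "?c x \<le> J" for x
    unfolding catenary_degree_le_iff by simp
  \<comment> \<open>Elements of catenary degree zero contribute nothing, so the levels from \<open>1\<close> on suffice.\<close>
  have "extend_by_zero \<Gamma> (\<lambda>x. of_nat (?c x)) x =
      (\<Sum>p\<in>Sigma {1..J} \<C>. if x \<in> snd p then of_nat (fst p) else 0)" for x
  proof -
    have "(\<Sum>p\<in>Sigma {1..J} \<C>. if x \<in> snd p then of_nat (fst p) else 0) =
        (\<Sum>j\<in>{1..J}. \<Sum>D\<in>\<C> j. if x \<in> D then of_nat j else (0::rat))"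
      using C(1) by (subst sum.Sigma) (auto simp: case_prod_unfold)
    also have "\<dots> = (\<Sum>j\<in>{1..J}. if x \<in> {x \<in> \<Gamma>. ?c x = j} then of_nat j else 0)"
      using C by (intro sum.cong refl) (simp add: disjoint_sum_indicator)
    also have "\<dots> = (\<Sum>j\<in>{1..J}. if j = ?c x then (if x \<in> \<Gamma> then of_nat (?c x) else 0) else 0)"
      by (intro sum.cong refl) auto
    also have "\<dots> = extend_by_zero \<Gamma> (\<lambda>x. of_nat (?c x)) x"
      using bound[of x] by (auto simp: extend_by_zero_def Suc_le_eq)
    finally show ?thesis by simp
  qed
  moreover have "finite (Sigma {1..J} \<C>)"
    using C by (intro finite_SigmaI) auto
  moreover have "is_cone (snd p)" if "p \<in> Sigma {1..J} \<C>" for p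
    using C that by force
  ultimately have "eventually_quasiconstant (extend_by_zero \<Gamma> (\<lambda>x. of_nat (?c x)))"
    by (intro eventually_quasiconstantI[of "Sigma {1..J} \<C>" snd])
  moreover have "\<forall>j\<ge>2. \<exists>\<C>. finite \<C> \<and> (\<forall>C\<in>\<C>. is_cone C) \<and> disjoint \<C> \<and>
      {x \<in> \<Gamma>. ?c x = j} = \<Union>\<C>"
    using cones by simp
  ultimately show ?thesis
    by blast
qed

end
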